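(* Let $N\ge3$, $m=\frac{N-2}{N+2}$, $n=1-m$, $C^*=\frac{2m((1-m)N-2)}{n}$ and $\beta_1=\frac1{2m}$. For every $\beta>\beta_1$ and every $B>0$, with $\alpha=\frac{1+2\beta}{n}$ and $\gamma_1=\frac{\beta(N-2)-\sqrt{\beta^2(N-2)^2-4(N-2)}}{2}$, there exists a unique radially symmetric positive solution $g_{\beta,B}$ of $$\Delta g^{m}+\beta\,y\cdot\nabla g+\alpha g=0$$ that is smooth on $\mathbb R^N\setminus\{0\}$ and satisfies $$g_{\beta,B}(y)=\Big(\frac{C^*}{|y|^2}\Big)^{1/n}\big(1+B|y|^{-\gamma_1}+o(|y|^{-\gamma_1})\big)\quad\text{as }|y|\to\infty$$ and $$g_{\beta,B}(y)=K_B\,|y|^{-\alpha/\beta}(1+o(1))\quad\text{as }|y|\to0,$$ where $K_B>0$ is a constant depending on $B$.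
   Context: The $o$-term at infinity may depend on $B$. The constant $C^*=\frac{(N-2)^2}{N+2}$ is the one for which $\big(C^*(T-t)/|x|^2\big)^{1/n}$ solves $u_t=\Delta u^m$ on $(\mathbb R^N\setminus\{0\})\times(-\infty,T)$. The profile $g_{\beta,B}$ yields the singular self-similar solution $V_{\beta,B}(x,t)=(T-t)^\alpha g_{\beta,B}(x(T-t)^\beta)$ of $u_t=\Delta u^m$. *)

theory Defs
  imports "HOL-Analysis.Analysis" "HOL-Library.Landau_Symbols"
begin

text \<open>Partial derivative in direction \<open>b\<close>. Outside points of differentiability
  the value is unspecified; below it is only used on open sets where the function is
  required to be smooth.\<close>

definition partial :: "'a::euclidean_space \<Rightarrow> ('a \<Rightarrow> real) \<Rightarrow> 'a \<Rightarrow> real" where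
  "partial b f x = frechet_derivative f (at x) b"

definition grad :: "('a::euclidean_space \<Rightarrow> real) \<Rightarrow> 'a \<Rightarrow> 'a" where
  "grad f x = (\<Sum>b\<in>Basis. partial b f x *\<^sub>R b)"

definition laplacian :: "('a::euclidean_space \<Rightarrow> real) \<Rightarrow> 'a \<Rightarrow> real" where
  "laplacian f x = (\<Sum>b\<in>Basis. partial b (partial b f) x)"

text \<open>\<open>Ck_on k f S\<close> means \<open>C\<^sup>k\<close> in the usual sense for an open set \<open>S\<close>.\<close>

fun Ck_on :: "nat \<Rightarrow> ('a::euclidean_space \<Rightarrow> real) \<Rightarrow> 'a set \<Rightarrow> bool" where
  "Ck_on 0 f S \<longleftrightarrow> continuous_on S f"
| "Ck_on (Suc k) f S \<longleftrightarrow>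
     (\<forall>x\<in>S. f differentiable (at x)) \<and> (\<forall>b\<in>Basis. Ck_on k (partial b f) S)"

definition smooth_on :: "('a::euclidean_space \<Rightarrow> real) \<Rightarrow> 'a set \<Rightarrow> bool" where
  "smooth_on f S \<longleftrightarrow> (\<forall>k. Ck_on k f S)"

text \<open>Functions on the punctured space are represented by total functions; their value
  at the origin is irrelevant in all of the following.\<close>

definition radially_symmetric :: "('a::euclidean_space \<Rightarrow> real) \<Rightarrow> bool" where
  "radially_symmetric g \<longleftrightarrow> (\<forall>x y. x \<noteq> 0 \<longrightarrow> y \<noteq> 0 \<longrightarrow> norm x = norm y \<longrightarrow> g x = g y)"

definition radial_positive_solution ::
  "real \<Rightarrow> real \<Rightarrow> real \<Rightarrow> ('a::euclidean_space \<Rightarrow> real) \<Rightarrow> bool" where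
  "radial_positive_solution m \<alpha> \<beta> g \<longleftrightarrow>
     radially_symmetric g \<and>
     (\<forall>y. y \<noteq> 0 \<longrightarrow> g y > 0) \<and>
     smooth_on g (- {0}) \<and>
     (\<forall>y. y \<noteq> 0 \<longrightarrow>
        laplacian (\<lambda>x. g x powr m) y + \<beta> * (y \<bullet> grad g y) + \<alpha> * g y = 0)"

definition asymptotics_at_infinity ::
  "real \<Rightarrow> real \<Rightarrow> real \<Rightarrow> real \<Rightarrow> ('a::euclidean_space \<Rightarrow> real) \<Rightarrow> bool" where
  "asymptotics_at_infinity C n B \<gamma> g \<longleftrightarrow>
     (\<exists>e. e \<in> o[at_infinity](\<lambda>y. norm y powr (- \<gamma>)) \<and>
        (\<forall>\<^sub>F y in at_infinity.
           g y = (C / (norm y)\<^sup>2) powr (1 / n) * (1 + B * norm y powr (- \<gamma>) + e y)))"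

definition asymptotics_at_zero ::
  "real \<Rightarrow> real \<Rightarrow> real \<Rightarrow> ('a::euclidean_space \<Rightarrow> real) \<Rightarrow> bool" where
  "asymptotics_at_zero \<alpha> \<beta> K g \<longleftrightarrow>
     (\<exists>e. e \<in> o[at 0](\<lambda>_. 1) \<and>
        (\<forall>\<^sub>F y in at 0. g y = K * norm y powr (- (\<alpha> / \<beta>)) * (1 + e y)))"

definition is_profile ::
  "real \<Rightarrow> real \<Rightarrow> real \<Rightarrow> real \<Rightarrow> real \<Rightarrow> real \<Rightarrow> real \<Rightarrow> ('a::euclidean_space \<Rightarrow> real) \<Rightarrow> bool"
where
  "is_profile m n C \<alpha> \<beta> \<gamma> B g \<longleftrightarrow>
     radial_positive_solution m \<alpha> \<beta> g \<and>
     asymptotics_at_infinity C n B \<gamma> g \<and>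
     (\<exists>K>0. asymptotics_at_zero \<alpha> \<beta> K g)"

end

theory Submission
  imports Defs
begin

text \<open>With \<open>s = ln |y|\<close>, \<open>p = 1 / m\<close>, \<open>a = (N - 2) / 2\<close> and \<open>g = |y| powr (- 2 / n) * v powr p\<close>, the radial
  equation becomes the autonomous \<open>v'' - a\<^sup>2 v + \<beta> (v powr p)' + (1 / n) v powr p = 0\<close>. Setting
  \<open>e = v' - c v + \<beta> v powr p\<close> with \<open>c = 1 / (n \<beta>)\<close> turns it into the system
  \<open>v' = e + c v - \<beta> v powr p\<close>, \<open>e' = (a\<^sup>2 - c\<^sup>2) v - c e\<close>, which is cooperative exactly when
  \<open>\<beta> > 1 / (2 m)\<close>. A solution on the whole line which blows up like \<open>exp (- c s / p)\<close> at \<open>-\<infinity>\<close> is then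
  found by monotone iteration between \<open>0\<close> and a supersolution. For \<open>s \<longrightarrow> \<infinity>\<close> it enters the node
  \<open>v powr (p - 1) = C\<close> below the slow eigendirection, and a Lyapunov function shows that the coefficient of
  \<open>exp (- \<gamma>\<^sub>1 s)\<close> is positive; translating in \<open>s\<close> gives it any prescribed positive value.
  An energy estimate for the difference of two solutions shows that the solution is determined by its
  leading coefficient at \<open>-\<infinity>\<close>, hence unique up to translation, and \<open>B\<close> fixes the translation.\<close>

section \<open>Calculus of radial functions\<close>

text \<open>The equation for \<open>e\<close> contains the term
  \<open>(c * \<beta> - 1 / n) * v powr p\<close>. The choice of \<open>c\<close> cancels it, so
  that equation is linear and cooperativity becomes the sign of
  \<open>a\<^sup>2 - c\<^sup>2\<close>. The same \<open>c\<close> is the blow-up exponent, because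
  \<open>\<alpha> / \<beta> = 2 / n + c\<close>. The obstacle is that the data sit at
  \<open>-\<infinity>\<close>, where both \<open>v\<close> and the damping
  \<open>\<beta> * p * v powr (p - 1)\<close> are unbounded, so no initial value problem is
  available. Both equations are integrated from \<open>-\<infinity>\<close> instead. The homogeneous
  part \<open>exp (- c * s)\<close> of \<open>e\<close>, taken with coefficient 1, carries the
  singular data and forces \<open>\<beta> * v powr p * exp (c * s)\<close> to tend to 1. At the
  node, the slow coefficient could a priori be zero or negative. On the right side of the slow
  eigendirection a logarithmic form of this coefficient is monotone, and an upper bound for it gives
  a finite limit, whose exponential is positive.\<close>

lemma partial_eq: "(f has_derivative D) (at x) \<Longrightarrow> partial b f x = D b"
  by (metis partial_def frechet_derivative_at)

lemma partial_cong:
  assumes "open S" "x \<in> S" "\<And>y. y \<in> S \<Longrightarrow> f y = g y"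
  shows "partial b f x = partial b g x"
proof -
  have "(f has_derivative D) (at x) \<longleftrightarrow> (g has_derivative D) (at x)" for D
    using assms has_derivative_transform_within_open[of _ D x UNIV S] by metis
  then show ?thesis
    by (simp add: partial_def frechet_derivative_def)
qed

section \<open>Closure properties of C^k functions on open sets\<close>

lemma Ck_on_cong:
  assumes "open S" "\<And>x. x \<in> S \<Longrightarrow> f x = g x" "Ck_on k f S"
  shows "Ck_on k g S"
  using assms(2,3)
proof (induction k arbitrary: f g)
  case 0
  then show ?case by (auto cong: continuous_on_cong)
next
  case (Suc k)
  have "g differentiable at x" if "x \<in> S" for x
    using Suc.prems that has_derivative_transform_within_open[OF _ \<open>open S\<close> that]
    by (fastforce simp: differentiable_def)
  moreover have "Ck_on k (partial b g) S" if "b \<in> Basis" for b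
    using Suc.IH[of "partial b f" "partial b g"] Suc.prems that
      partial_cong[OF \<open>open S\<close>, of _ f g] by auto
  ultimately show ?case by simp
qed

lemma Ck_on_SucD: "Ck_on (Suc k) f S \<Longrightarrow> Ck_on k f S"
proof (induction k arbitrary: f)
  case 0
  then show ?case
    by (simp add: continuous_at_imp_continuous_on differentiable_imp_continuous_within)
next
  case (Suc k)
  then show ?case by (metis Ck_on.simps(2))
qed

lemma Ck_on_SucI:
  assumes "open S" "\<And>x. x \<in> S \<Longrightarrow> (f has_derivative D x) (at x)"
    and "\<And>b. b \<in> Basis \<Longrightarrow> Ck_on k (\<lambda>x. D x b) S"
  shows "Ck_on (Suc k) f S"
proof -
  have "Ck_on k (partial b f) S" if "b \<in> Basis" for b
    using Ck_on_cong[OF assms(1) _ assms(3)[OF that]] partial_eq[OF assms(2)] by metis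
  then show ?thesis
    using assms(2) by (auto simp: differentiable_def)
qed

lemma Ck_on_const: "Ck_on k (\<lambda>x::'a::euclidean_space. r) S"
proof (induction k arbitrary: r)
  case (Suc k)
  have "partial b (\<lambda>x. r) = (\<lambda>x. 0)" for b :: 'a
    by (auto simp: fun_eq_iff intro!: partial_eq[where D="\<lambda>_. 0"])
  with Suc[of 0] show ?case by simp
qed simp

lemma Ck_on_add:
  assumes "open S" "Ck_on k f S" "Ck_on k g S"
  shows "Ck_on k (\<lambda>x. f x + g x) S"
  using assms(2,3)
proof (induction k arbitrary: f g)
  case 0
  then show ?case by (auto intro: continuous_intros)
next
  case (Suc k)
  show ?case
  proof (rule Ck_on_SucI[OF \<open>open S\<close>])
    fix x assume "x \<in> S"
    with Suc.prems show "((\<lambda>x. f x + g x) has_derivative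
        (\<lambda>b. partial b f x + partial b g x)) (at x)"
      unfolding partial_def by (auto intro!: has_derivative_add simp flip: frechet_derivative_works)
  qed (use Suc in auto)
qed

lemma Ck_on_mult:
  assumes "open S" "Ck_on k f S" "Ck_on k g S"
  shows "Ck_on k (\<lambda>x. f x * g x) S"
  using assms(2,3)
proof (induction k arbitrary: f g)
  case 0
  then show ?case by (auto intro: continuous_intros)
next
  case (Suc k)
  show ?case
  proof (rule Ck_on_SucI[OF \<open>open S\<close>])
    fix x assume "x \<in> S"
    with Suc.prems show "((\<lambda>x. f x * g x) has_derivative
        (\<lambda>b. f x * partial b g x + partial b f x * g x)) (at x)"
      unfolding partial_def by (auto intro!: has_derivative_mult simp flip: frechet_derivative_works)
  next
    fix b :: 'a assume "b \<in> Basis"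
    with Suc.prems have "Ck_on k (partial b f) S" "Ck_on k (partial b g) S"
        "Ck_on k f S" "Ck_on k g S"
      using Ck_on_SucD by auto
    then show "Ck_on k (\<lambda>x. f x * partial b g x + partial b f x * g x) S"
      using Suc.IH Ck_on_add[OF \<open>open S\<close>] by blast
  qed
qed

section \<open>Gradient and Laplacian of radial functions\<close>

lemma has_derivative_radial:
  fixes x :: "'a::euclidean_space"
  assumes "x \<noteq> 0" "(G has_real_derivative d) (at (norm x))"
    and "\<And>y. y \<noteq> 0 \<Longrightarrow> f y = G (norm y)"
  shows "(f has_derivative (\<lambda>h. d / norm x * (x \<bullet> h))) (at x)"
proof -
  have "((\<lambda>y. G (norm y)) has_derivative (\<lambda>h. d * (sgn x \<bullet> h))) (at x)"
    using has_derivative_compose[OF has_derivative_norm[OF assms(1)]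
        assms(2)[unfolded has_field_derivative_def]]
    by (simp add: inner_commute)
  then have "(f has_derivative (\<lambda>h. d * (sgn x \<bullet> h))) (at x)"
    by (rule has_derivative_transform_within_open[of _ _ _ _ "-{0}"]) (use assms in auto)
  then show ?thesis
    by (simp add: sgn_div_norm divide_inverse mult.assoc)
qed

lemma partial_radial:
  fixes x :: "'a::euclidean_space"
  assumes "x \<noteq> 0" "(G has_real_derivative d) (at (norm x))"
    and "\<And>y. y \<noteq> 0 \<Longrightarrow> f y = G (norm y)"
  shows "partial b f x = d / norm x * (x \<bullet> b)"
  using partial_eq[OF has_derivative_radial[OF assms]] .

lemma sum_inner_Basis_square: "(\<Sum>b\<in>Basis. (x \<bullet> b)\<^sup>2) = (norm (x::'a::euclidean_space))\<^sup>2"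
  unfolding power2_norm_eq_inner euclidean_inner[of x x] by (simp add: power2_eq_square)

lemma inner_grad_radial:
  fixes y :: "'a::euclidean_space"
  assumes "y \<noteq> 0" "(G has_real_derivative d) (at (norm y))"
    and "\<And>y. y \<noteq> 0 \<Longrightarrow> f y = G (norm y)"
  shows "y \<bullet> grad f y = norm y * d"
proof -
  have "y \<bullet> grad f y = (\<Sum>b\<in>Basis. d / norm y * (y \<bullet> b)\<^sup>2)"
    by (simp add: grad_def inner_sum_right partial_radial[OF assms] power2_eq_square mult.assoc)
  also have "\<dots> = d / norm y * (norm y)\<^sup>2"
    by (simp only: sum_inner_Basis_square flip: sum_distrib_left)
  finally show ?thesis
    using assms(1) by (simp add: power2_eq_square)
qed

lemma laplacian_radial:
  fixes y :: "'a::euclidean_space"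
  assumes "y \<noteq> 0"
    and G1: "\<And>r. r > 0 \<Longrightarrow> (G has_real_derivative G1 r) (at r)"
    and G2: "\<And>r. r > 0 \<Longrightarrow> (G1 has_real_derivative G2 r) (at r)"
    and f: "\<And>y. y \<noteq> 0 \<Longrightarrow> f y = G (norm y)"
  shows "laplacian f y = G2 (norm y) + (real DIM('a) - 1) / norm y * G1 (norm y)"
proof -
  define r where "r = norm y"
  have r: "r > 0" using assms by (simp add: r_def)
  \<comment> \<open>Since \<open>partial b f x = q (norm x) * (x \<bullet> b)\<close>, one product
    rule yields all second derivatives, and the squares \<open>(y \<bullet> b)\<^sup>2\<close> sum
    to \<open>r\<^sup>2\<close>.\<close>
  define q where "q = (\<lambda>r. G1 r / r)"
  define dq where "dq = G2 r / r - G1 r / r\<^sup>2"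
  have "(q has_real_derivative dq) (at r)"
    unfolding q_def dq_def using G2[OF r] r
    by (auto intro!: derivative_eq_intros simp: field_simps power2_eq_square)
  then have q: "((\<lambda>x. q (norm x)) has_derivative (\<lambda>h. dq / r * (y \<bullet> h))) (at y)"
    unfolding r_def by (rule has_derivative_radial[OF assms(1)]) simp
  have "partial b (partial b f) y = q r + dq / r * (y \<bullet> b)\<^sup>2" if "b \<in> Basis" for b
  proof -
    have "partial b f x = q (norm x) * (x \<bullet> b)" if "x \<noteq> 0" for x
      using partial_radial[OF that G1 f] that by (simp add: q_def)
    then have "partial b (partial b f) y = partial b (\<lambda>x. q (norm x) * (x \<bullet> b)) y"
      using assms(1) by (intro partial_cong[of "-{0}"]) auto
    also have "\<dots> = q r * (b \<bullet> b) + dq / r * (y \<bullet> b) * (y \<bullet> b)"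
      by (rule partial_eq) (auto intro!: derivative_eq_intros q simp: r_def)
    finally show ?thesis
      using that by (simp add: power2_eq_square inner_Basis)
  qed
  then have "laplacian f y = (\<Sum>b\<in>(Basis::'a set). q r) + (\<Sum>b\<in>Basis. dq / r * (y \<bullet> b)\<^sup>2)"
    by (simp add: laplacian_def sum.distrib)
  also have "(\<Sum>b\<in>Basis. dq / r * (y \<bullet> b)\<^sup>2) = dq / r * r\<^sup>2"
    by (simp only: sum_inner_Basis_square r_def flip: sum_distrib_left)
  also have "\<dots> = G2 r - G1 r / r"
    using r by (simp add: dq_def power2_eq_square field_simps)
  finally show ?thesis
    using r unfolding r_def[symmetric] q_def by (simp add: field_simps)
qed

section \<open>Monotone iteration for the cooperative system\<close>

lemma improper_integral_bounds:
  fixes f H H' :: "real \<Rightarrow> real"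
  assumes cont: "continuous_on UNIV f"
    and f: "\<And>x. 0 \<le> f x" "\<And>x. f x \<le> H' x"
    and H: "\<And>x. (H has_real_derivative H' x) (at x)" "\<And>x. 0 \<le> H x"
  shows "f integrable_on {..s}" "0 \<le> integral {..s} f" "integral {..s} f \<le> H s"
proof -
  let ?f = "\<lambda>k x. if x \<in> {- real k..s} then f x else 0"
  have int: "f integrable_on {a..b}" for a b
    by (meson cont continuous_on_subset integrable_continuous_interval top_greatest)
  have fk: "(?f k has_integral integral {- real k..s} f) {..s}" for k
    using int has_integral_restrict[of "{- real k..s}" "{..s}" f]
    by (auto simp: integrable_integral)
  \<comment> \<open>\<open>H\<close> need not vanish at \<open>-\<infinity>\<close>: being
    nonnegative, it gives \<open>H s - H (- real k) \<le> H s\<close>. For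
    \<open>s < - real k\<close> the interval is empty and the integral is 0.\<close>
  have bd: "0 \<le> integral {- real k..s} f \<and> integral {- real k..s} f \<le> H s" for k
  proof (cases "- real k \<le> s")
    case True
    have "(H' has_integral H s - H (- real k)) {- real k..s}"
      using True H(1) by (intro fundamental_theorem_of_calculus)
        (auto simp flip: has_real_derivative_iff_has_vector_derivative
          intro: has_field_derivative_at_within)
    then have "integral {- real k..s} f \<le> H s - H (- real k)"
      using has_integral_le[OF integrable_integral[OF int]] f by blast
    then show ?thesis
      using H(2)[of "- real k"] f by (auto intro!: integral_nonneg int)
  qed (use H in simp)
  have "f integrable_on {..s} \<and> (\<lambda>k. integral {..s} (?f k)) \<longlonglongrightarrow> integral {..s} f"
  proof (rule monotone_convergence_increasing)
    show "bounded (range (\<lambda>k. integral {..s} (?f k)))"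
      unfolding bounded_iff using bd fk[THEN integral_unique] by (intro exI[of _ "H s"]) auto
    show "(\<lambda>k. ?f k x) \<longlonglongrightarrow> f x" if "x \<in> {..s}" for x
    proof (rule tendsto_eventually)
      obtain K where "- x \<le> real K"
        using real_arch_simple by blast
      then show "\<forall>\<^sub>F k in sequentially. ?f k x = f x"
        using that by (intro eventually_sequentiallyI[of K]) auto
    qed
  qed (use fk f in \<open>auto simp: integrable_on_def\<close>)
  then have lim: "f integrable_on {..s}"
      "(\<lambda>k. integral {- real k..s} f) \<longlonglongrightarrow> integral {..s} f"
    using fk[THEN integral_unique] by auto
  show "f integrable_on {..s}" by fact
  show "0 \<le> integral {..s} f" "integral {..s} f \<le> H s"
    using bd LIMSEQ_le_const[OF lim(2), of 0] LIMSEQ_le_const2[OF lim(2), of "H s"] by auto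
qed

lemma improper_integral_split:
  fixes f :: "real \<Rightarrow> real"
  assumes "\<And>s. f integrable_on {..s}" "a \<le> s"
  shows "integral {..s} f = integral {..a} f + integral {a..s} f"
proof -
  have "f integrable_on {a..s}"
    using integrable_on_subinterval[of f "{..s}" a s] assms(1) by auto
  then have "(f has_integral integral {..a} f + integral {a..s} f) ({..a} \<union> {a..s})"
    using assms by (intro has_integral_Un integrable_integral) (auto intro: negligible_subset[of "{a}"])
  moreover have "{..a} \<union> {a..s} = {..s}"
    using assms(2) by auto
  ultimately show ?thesis
    by (metis integral_unique)
qed

text \<open>Only integrability is assumed, since the limit of the monotone iteration is not known to
  be continuous before this lemma has been applied to its fixed-point equation.\<close>

lemma continuous_on_improper_integral:
  fixes f :: "real \<Rightarrow> real"
  assumes "\<And>s. f integrable_on {..s}"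
  shows "continuous_on UNIV (\<lambda>s. integral {..s} f)"
  unfolding continuous_on_eq_continuous_at[OF open_UNIV]
proof
  fix s
  have "f integrable_on {s-1..s+1}"
    using integrable_on_subinterval[of f "{..s+1}" "s-1" "s+1"] assms by auto
  then have "continuous_on {s-1..s+1} (\<lambda>t. integral {..s-1} f + integral {s-1..t} f)"
    by (intro continuous_intros indefinite_integral_continuous_1)
  then have "continuous_on {s-1..s+1} (\<lambda>t. integral {..t} f)"
    by (rule continuous_on_eq) (use improper_integral_split[OF assms] in auto)
  then show "isCont (\<lambda>s. integral {..s} f) s"
    by (rule continuous_on_interior) auto
qed

lemma improper_integral_has_derivative:
  fixes f :: "real \<Rightarrow> real"
  assumes "\<And>s. f integrable_on {..s}" "continuous_on UNIV f"
  shows "((\<lambda>s. integral {..s} f) has_real_derivative f s) (at s)"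
proof -
  have "((\<lambda>t. integral {s-1..t} f) has_real_derivative f s) (at s within {s-1..s+1})"
    using continuous_on_subset[OF assms(2)] by (intro integral_has_real_derivative) auto
  then have "((\<lambda>t. integral {s-1..t} f) has_real_derivative f s) (at s)"
    by (simp add: at_within_interior[of s "{s-1..s+1}"])
  then have "((\<lambda>t. integral {..s-1} f + integral {s-1..t} f) has_real_derivative f s) (at s)"
    using DERIV_add[OF DERIV_const, of "\<lambda>t. integral {s-1..t} f" "f s" s UNIV] by simp
  then show ?thesis
    by (rule has_field_derivative_transform_within_open[where S="{s-1<..}"])
      (auto intro!: improper_integral_split[symmetric] assms)
qed

lemma antiderivative_exists:
  fixes f :: "real \<Rightarrow> real"
  assumes "continuous_on UNIV f"
  obtains F where "\<And>s. (F has_real_derivative f s) (at s)"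
proof -
  have "\<exists>F. \<forall>x. - \<infinity> < ereal x \<longrightarrow> ereal x < \<infinity> \<longrightarrow> (F has_vector_derivative f x) (at x)"
    using assms by (intro einterval_antiderivative) (auto simp: continuous_on_eq_continuous_at)
  then show thesis
    using that by (auto simp: has_real_derivative_iff_has_vector_derivative)
qed

text \<open>The mean value theorem asks for differentiability only inside the interval, so
  \<open>x = 0\<close> is allowed. The factor is a Lipschitz constant of \<open>t powr p\<close> on
  \<open>{0..u}\<close>.\<close>

lemma powr_diff_le:
  fixes x y u p :: real
  assumes "0 \<le> x" "x \<le> y" "y \<le> u" "1 < p"
  shows "y powr p - x powr p \<le> p * u powr (p - 1) * (y - x)"
proof (cases "x < y")
  case True
  have "\<exists>l z. x < z \<and> z < y \<and> ((\<lambda>t. t powr p) has_real_derivative l) (at z) \<and>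
      y powr p - x powr p = (y - x) * l"
  proof (rule MVT[OF True])
    show "continuous_on {x..y} (\<lambda>t. t powr p)"
      using assms by (intro continuous_on_powr' continuous_intros) auto
    show "(\<lambda>t. t powr p) differentiable (at z)" if "x < z" "z < y" for z
      using that assms has_real_derivative_powr[of z p]
      by (auto simp: real_differentiable_def)
  qed
  then obtain l z where z: "x < z" "z < y" "((\<lambda>t. t powr p) has_real_derivative l) (at z)"
      "y powr p - x powr p = (y - x) * l" by blast
  have "l = p * z powr (p - 1)"
    using z assms has_real_derivative_powr[of z p] by (auto intro: DERIV_unique)
  moreover have "z powr (p - 1) \<le> u powr (p - 1)"
    using z assms by (intro powr_mono2) auto
  ultimately show ?thesis
    using z assms by (auto simp: mult.commute intro!: mult_left_mono)
qed (use assms in auto)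

section \<open>The cooperative system and its monotone operator\<close>

locale cooperative =
  fixes c \<kappa> \<beta> p :: real
  assumes c: "0 < c" and \<kappa>: "0 < \<kappa>" and \<beta>: "0 < \<beta>" and p: "1 < p"
begin

definition solution :: "(real \<Rightarrow> real) \<Rightarrow> (real \<Rightarrow> real) \<Rightarrow> bool" where
  "solution v e \<longleftrightarrow> (\<forall>s. 0 < v s \<and>
     (v has_real_derivative e s + c * v s - \<beta> * v s powr p) (at s) \<and>
     (e has_real_derivative \<kappa> * v s - c * e s) (at s))"

end

text \<open>The nonlocal term enters only through a majorant: \<open>H\<close> is nonnegative and
  its derivative dominates \<open>\<kappa> * (exp (c * s) * u s)\<close>, so \<open>1 + H\<close>
  bounds the factor that the second equation produces for any \<open>v\<close> between 0 and
  \<open>u\<close>. The last condition is the first equation as an inequality, with \<open>e\<close>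
  replaced by this bound.\<close>

locale supersolution = cooperative +
  fixes u u' H H' :: "real \<Rightarrow> real"
  assumes u_deriv: "(u has_real_derivative u' s) (at s)" and u_pos: "0 < u s"
    and H_deriv: "(H has_real_derivative H' s) (at s)" and H_nonneg: "0 \<le> H s"
    and H'_ge: "\<kappa> * (exp (c * s) * u s) \<le> H' s"
    and u'_ge: "exp (- c * s) * (1 + H s) + c * u s - \<beta> * u s powr p \<le> u' s"
begin

text \<open>For a given \<open>v\<close>, the second equation is solved by \<open>exp (- c s) X v s\<close>. Adding \<open>\<Lambda> v\<close> to
  both sides of the first one, where \<open>\<Lambda> s\<close> is a Lipschitz constant of the reaction term on
  \<open>{0..u s}\<close>, makes its right-hand side \<open>R\<close> monotone; \<open>exp M\<close> is the integrating factor, so that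
  solutions are fixed points of the monotone operator \<open>T\<close>.\<close>

definition X :: "(real \<Rightarrow> real) \<Rightarrow> real \<Rightarrow> real" where
  "X v s = 1 + \<kappa> * integral {..s} (\<lambda>t. exp (c * t) * v t)"

definition \<Lambda> :: "real \<Rightarrow> real" where
  "\<Lambda> s = \<beta> * (p * u s powr (p - 1))"

definition M :: "real \<Rightarrow> real" where
  "M = (SOME M. \<forall>s. (M has_real_derivative \<Lambda> s) (at s))"

definition R :: "(real \<Rightarrow> real) \<Rightarrow> real \<Rightarrow> real" where
  "R v s = exp (- c * s) * X v s + (c * v s + (\<Lambda> s * v s - \<beta> * v s powr p))"

definition T :: "(real \<Rightarrow> real) \<Rightarrow> real \<Rightarrow> real" where
  "T v s = exp (- M s) * integral {..s} (\<lambda>t. exp (M t) * R v t)"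

definition admissible :: "(real \<Rightarrow> real) \<Rightarrow> bool" where
  "admissible v \<longleftrightarrow> continuous_on UNIV v \<and> (\<forall>s. 0 \<le> v s \<and> v s \<le> u s)"

lemma u_cont: "continuous_on S u"
  using DERIV_isCont[OF u_deriv] by (auto intro: continuous_at_imp_continuous_on)

lemma \<Lambda>_cont: "continuous_on S \<Lambda>"
  unfolding \<Lambda>_def by (intro continuous_intros u_cont) (metis u_pos less_irrefl)

lemma M_deriv: "(M has_real_derivative \<Lambda> s) (at s)"
proof -
  obtain F where "\<And>s. (F has_real_derivative \<Lambda> s) (at s)"
    using antiderivative_exists[OF \<Lambda>_cont] by blast
  then have "\<forall>s. (F has_real_derivative \<Lambda> s) (at s)"
    by blast
  then have "\<forall>s. (M has_real_derivative \<Lambda> s) (at s)"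
    unfolding M_def by (rule someI[where P="\<lambda>M. \<forall>s. (M has_real_derivative \<Lambda> s) (at s)"])
  then show ?thesis ..
qed

lemma M_cont: "continuous_on S M"
  using DERIV_isCont[OF M_deriv] by (auto intro: continuous_at_imp_continuous_on)

lemma X_integral:
  assumes "admissible v"
  shows "(\<lambda>t. exp (c * t) * v t) integrable_on {..s}"
    and "0 \<le> integral {..s} (\<lambda>t. exp (c * t) * v t)"
    and "integral {..s} (\<lambda>t. exp (c * t) * v t) \<le> H s / \<kappa>"
proof -
  note * = improper_integral_bounds[of "\<lambda>t. exp (c * t) * v t" "\<lambda>t. H' t / \<kappa>" "\<lambda>t. H t / \<kappa>" s]
  have "exp (c * t) * v t \<le> H' t / \<kappa>" for t
  proof -
    have "\<kappa> * (exp (c * t) * v t) \<le> \<kappa> * (exp (c * t) * u t)"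
      using assms \<kappa> by (auto simp: admissible_def)
    also have "\<dots> \<le> H' t"
      by (rule H'_ge)
    finally show ?thesis
      using \<kappa> by (simp add: field_simps)
  qed
  with assms \<kappa> H_nonneg show "(\<lambda>t. exp (c * t) * v t) integrable_on {..s}"
    and "0 \<le> integral {..s} (\<lambda>t. exp (c * t) * v t)"
    and "integral {..s} (\<lambda>t. exp (c * t) * v t) \<le> H s / \<kappa>"
    by (intro *; auto simp: admissible_def intro!: continuous_intros DERIV_cdivide H_deriv)+
qed

lemma X_bounds:
  assumes "admissible v"
  shows "1 \<le> X v s" "X v s \<le> 1 + H s"
  using X_integral[OF assms, of s] \<kappa> by (auto simp: X_def field_simps)

lemma X_cont: "admissible v \<Longrightarrow> continuous_on UNIV (X v)"
  unfolding X_def by (intro continuous_intros continuous_on_improper_integral X_integral)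

lemma reaction_mono:
  assumes "0 \<le> x" "x \<le> y" "y \<le> u s"
  shows "\<Lambda> s * x - \<beta> * x powr p \<le> \<Lambda> s * y - \<beta> * y powr p"
proof -
  have "\<beta> * (y powr p - x powr p) \<le> \<beta> * (p * u s powr (p - 1) * (y - x))"
    using powr_diff_le[OF assms p] \<beta> by simp
  then show ?thesis
    by (simp add: \<Lambda>_def algebra_simps)
qed

lemma R_mono:
  assumes "X v s \<le> X w s" "0 \<le> v s" "v s \<le> w s" "w s \<le> u s"
  shows "R v s \<le> R w s"
  unfolding R_def using assms c by (intro add_mono reaction_mono) auto

text \<open>The modified reaction term lies between its values at 0 and at \<open>u s\<close>. The
  first is 0, which leaves the nonlocal term; the second is controlled by the supersolution
  inequality.\<close>

lemma R_bounds:
  assumes "admissible v"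
  shows "exp (- c * s) * X v s \<le> R v s" "R v s \<le> u' s + \<Lambda> s * u s"
proof -
  have v: "0 \<le> v s" "v s \<le> u s"
    using assms by (auto simp: admissible_def)
  show "exp (- c * s) * X v s \<le> R v s"
    using reaction_mono[OF order.refl v] c v by (simp add: R_def)
  have "R v s \<le> exp (- c * s) * (1 + H s) + (c * u s + (\<Lambda> s * u s - \<beta> * u s powr p))"
    unfolding R_def using X_bounds[OF assms] v c by (intro add_mono reaction_mono) auto
  with u'_ge[of s] show "R v s \<le> u' s + \<Lambda> s * u s"
    by linarith
qed

lemma R_cont:
  assumes "admissible v"
  shows "continuous_on UNIV (R v)"
  unfolding R_def
  using assms p by (intro continuous_intros X_cont \<Lambda>_cont continuous_on_powr')
    (auto simp: admissible_def)

lemma super_deriv: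
  "((\<lambda>t. exp (M t) * u t) has_real_derivative exp (M t) * (u' t + \<Lambda> t * u t)) (at t)"
  by (auto intro!: derivative_eq_intros M_deriv u_deriv simp: algebra_simps)

lemma R_nonneg: "admissible v \<Longrightarrow> 0 \<le> R v s"
  using X_bounds(1)[of v s] by (intro order_trans[OF _ R_bounds(1)]) simp_all

text \<open>\<open>exp (M s) * u s\<close> serves as the nonnegative majorant, as its derivative
  dominates the integrand by \<open>R_bounds\<close>. Convergence at \<open>-\<infinity>\<close> and
  the bound of \<open>T v\<close> by \<open>u\<close> come from the same estimate.\<close>

lemma T_integral:
  assumes "admissible v"
  shows "(\<lambda>t. exp (M t) * R v t) integrable_on {..s}"
    and "0 \<le> integral {..s} (\<lambda>t. exp (M t) * R v t)"
    and "integral {..s} (\<lambda>t. exp (M t) * R v t) \<le> exp (M s) * u s"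
proof -
  have "continuous_on UNIV (\<lambda>t. exp (M t) * R v t)"
    by (intro continuous_intros M_cont R_cont assms)
  note * = improper_integral_bounds[OF this _ _ super_deriv, of s]
  show "(\<lambda>t. exp (M t) * R v t) integrable_on {..s}"
    and "0 \<le> integral {..s} (\<lambda>t. exp (M t) * R v t)"
    and "integral {..s} (\<lambda>t. exp (M t) * R v t) \<le> exp (M s) * u s"
    by (rule *; use R_bounds(2)[OF assms] R_nonneg[OF assms] u_pos in \<open>auto simp: less_imp_le\<close>)+
qed

lemma T_admissible:
  assumes "admissible v"
  shows "admissible (T v)"
proof -
  have "continuous_on UNIV (T v)"
    unfolding T_def
    by (intro continuous_intros M_cont continuous_on_improper_integral T_integral assms)
  moreover have "0 \<le> T v s \<and> T v s \<le> u s" for s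
  proof -
    have "T v s \<le> exp (- M s) * (exp (M s) * u s)"
      unfolding T_def using T_integral(3)[OF assms] by (intro mult_left_mono) auto
    then show ?thesis
      using T_integral(2)[OF assms, of s] by (auto simp: T_def simp flip: exp_add mult.assoc)
  qed
  ultimately show ?thesis
    by (simp add: admissible_def)
qed

lemma T_mono:
  assumes "admissible v" "admissible w" "\<And>s. v s \<le> w s"
  shows "T v s \<le> T w s"
proof -
  have "X v s \<le> X w s" for s
    unfolding X_def using \<kappa> assms
    by (auto intro!: integral_le X_integral)
  then have "R v s \<le> R w s" for s
    using assms by (intro R_mono) (auto simp: admissible_def)
  then show ?thesis
    unfolding T_def by (auto intro!: integral_le T_integral assms)
qed

text \<open>The iterates of \<open>T\<close> starting at 0 increase and stay below \<open>u\<close>,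
  hence converge pointwise. Dominated convergence, with the integrands belonging to \<open>u\<close>
  as majorants, makes the limit a fixed point.\<close>

lemma solution_exists:
  obtains v where "solution v (\<lambda>s. exp (- c * s) * X v s)" "admissible v"
proof -
  define V where "V k = (T ^^ k) (\<lambda>_. 0)" for k
  have V0: "admissible (V 0)"
    using u_pos by (auto simp: V_def admissible_def less_imp_le)
  have VS: "V (Suc k) = T (V k)" for k
    by (simp add: V_def)
  have adm: "admissible (V k)" for k
    by (induction k) (use V0 in \<open>auto simp: VS T_admissible\<close>)
  have bd: "0 \<le> V k s" "V k s \<le> u s" for k s
    using adm[of k] by (auto simp: admissible_def)
  have inc: "V k s \<le> V (Suc k) s" for k s
  proof (induction k arbitrary: s)
    case 0
    then show ?case using bd[of 1 s] by (simp add: V_def)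
  next
    case (Suc k)
    then show ?case using T_mono[OF adm adm] by (metis VS)
  qed
  define v where "v s = lim (\<lambda>k. V k s)" for s
  have lim: "(\<lambda>k. V k s) \<longlonglongrightarrow> v s" for s
  proof -
    have "incseq (\<lambda>k. V k s)"
      using inc by (rule incseq_SucI)
    moreover have "Bseq (\<lambda>k. V k s)"
      using bd by (intro BseqI'[of _ "u s"]) simp
    ultimately show ?thesis
      unfolding v_def by (simp add: Bseq_monoseq_convergent monoseq_iff flip: convergent_LIMSEQ_iff)
  qed
  have v: "0 \<le> v s" "v s \<le> u s" for s
    using LIMSEQ_le_const[OF lim, of 0 s] LIMSEQ_le_const2[OF lim, of s "u s"] bd by auto
  have adm_u: "admissible u"
    using u_cont u_pos by (auto simp: admissible_def less_imp_le)
  note dom = dominated_convergence[where S="{..s}" and f="\<lambda>k t. exp (c * t) * V k t"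
      and g="\<lambda>t. exp (c * t) * v t" and h="\<lambda>t. exp (c * t) * u t" for s]
  have intX: "(\<lambda>t. exp (c * t) * v t) integrable_on {..s}"
    and limX: "(\<lambda>k. integral {..s} (\<lambda>t. exp (c * t) * V k t)) \<longlonglongrightarrow>
      integral {..s} (\<lambda>t. exp (c * t) * v t)" for s
    by (rule dom[OF X_integral(1)[OF adm] X_integral(1)[OF adm_u]];
        use bd lim in \<open>auto simp: abs_mult intro!: tendsto_intros\<close>)+
  have "(\<lambda>k. X (V k) s) \<longlonglongrightarrow> X v s" for s
    unfolding X_def by (intro tendsto_intros limX)
  then have limR: "(\<lambda>k. R (V k) s) \<longlonglongrightarrow> R v s" for s
    unfolding R_def using p bd by (intro tendsto_intros lim tendsto_powr') auto
  note dom = dominated_convergence[where S="{..s}" and f="\<lambda>k t. exp (M t) * R (V k) t"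
      and g="\<lambda>t. exp (M t) * R v t" and h="\<lambda>t. exp (M t) * R u t" for s]
  have XX: "X (V k) s \<le> X u s" for k s
    unfolding X_def using \<kappa> bd
    by (auto intro!: integral_le X_integral adm adm_u)
  have R_le: "norm (exp (M t) * R (V k) t) \<le> exp (M t) * R u t" for k t
    using R_nonneg[OF adm, of k t] R_mono[OF XX bd(1) bd(2) order.refl, of k t] by (simp add: abs_mult)
  have intT: "(\<lambda>t. exp (M t) * R v t) integrable_on {..s}"
    and limT: "(\<lambda>k. integral {..s} (\<lambda>t. exp (M t) * R (V k) t)) \<longlonglongrightarrow>
      integral {..s} (\<lambda>t. exp (M t) * R v t)" for s
    by (rule dom[OF T_integral(1)[OF adm] T_integral(1)[OF adm_u] R_le];
        use limR in \<open>auto intro!: tendsto_intros\<close>)+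
  have "(\<lambda>k. T (V k) s) \<longlonglongrightarrow> T v s" for s
    unfolding T_def by (intro tendsto_intros limT)
  moreover have "(\<lambda>k. T (V k) s) \<longlonglongrightarrow> v s" for s
    unfolding VS[symmetric] using lim by (rule LIMSEQ_Suc)
  ultimately have Tv: "v s = T v s" for s
    using LIMSEQ_unique by blast
  \<comment> \<open>So far \<open>v\<close> is merely a pointwise limit. The fixed-point equation
    makes it continuous, as needed to differentiate the integrals.\<close>
  have "continuous_on UNIV (T v)"
    unfolding T_def by (intro continuous_intros M_cont continuous_on_improper_integral intT)
  moreover have "T v = v"
    using Tv by auto
  ultimately have admv: "admissible v"
    using v by (simp add: admissible_def)
  have dU: "((\<lambda>s. integral {..s} (\<lambda>t. exp (M t) * R v t)) has_real_derivative
      exp (M s) * R v s) (at s)" for s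
    by (intro improper_integral_has_derivative intT continuous_intros M_cont R_cont admv)
  have "((\<lambda>s. exp (- M s) * integral {..s} (\<lambda>t. exp (M t) * R v t)) has_real_derivative
      R v s - \<Lambda> s * T v s) (at s)" for s
    unfolding T_def
    by (auto intro!: derivative_eq_intros dU M_deriv simp: algebra_simps simp flip: exp_add)
  then have dv: "(v has_real_derivative R v s - \<Lambda> s * v s) (at s)" for s
    using \<open>T v = v\<close> by (simp flip: T_def)
  have dX: "(X v has_real_derivative \<kappa> * (exp (c * s) * v s)) (at s)" for s
    unfolding X_def using v admv
    by (auto intro!: derivative_eq_intros improper_integral_has_derivative intX continuous_intros
        simp: admissible_def)
  have Rpos: "0 < R v s" for s
    using X_bounds(1)[OF admv, of s] by (intro less_le_trans[OF _ R_bounds(1)[OF admv]]) simp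
  have "0 < v s" for s
  proof -
    let ?U = "\<lambda>s. integral {..s} (\<lambda>t. exp (M t) * R v t)"
    \<comment> \<open>The iteration yields only \<open>0 \<le> v\<close>. Strict positivity follows
      because the integrand is positive and the integral up to \<open>s - 1\<close> is
      nonnegative.\<close>
    have "?U (s - 1) < ?U s"
    proof (rule DERIV_pos_imp_increasing[of "s - 1"])
      show "\<exists>y. (?U has_real_derivative y) (at x) \<and> 0 < y" for x
        using dU Rpos mult_pos_pos[OF exp_gt_zero] by blast
    qed simp
    moreover have "0 \<le> ?U (s - 1)"
      by (rule T_integral[OF admv])
    ultimately show ?thesis
      by (subst Tv) (simp add: T_def)
  qed
  moreover have "((\<lambda>s. exp (- c * s) * X v s) has_real_derivative
      \<kappa> * v s - c * (exp (- c * s) * X v s)) (at s)" for s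
    by (auto intro!: derivative_eq_intros dX simp: algebra_simps simp flip: exp_add)
  moreover have "R v s - \<Lambda> s * v s = exp (- c * s) * X v s + c * v s - \<beta> * v s powr p" for s
    by (simp add: R_def)
  ultimately have "solution v (\<lambda>s. exp (- c * s) * X v s)"
    unfolding solution_def using dv by simp
  then show thesis
    using admv by (rule that)
qed

end

section \<open>The singular solution and its behaviour at minus infinity\<close>

lemma less_of_backward_growth:
  fixes f f' :: "real \<Rightarrow> real"
  assumes deriv: "\<And>s. (f has_real_derivative f' s) (at s)"
    and decr: "\<And>s. s \<le> s1 \<Longrightarrow> l \<le> f s \<Longrightarrow> f' s \<le> - 1"
    and bound: "\<And>s. s \<le> s1 \<Longrightarrow> f s \<le> A"
    and "s \<le> s1"
  shows "f s < l"
proof (rule ccontr)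
  assume "\<not> f s < l"
  then have fs: "l \<le> f s" by simp
  \<comment> \<open>Going backwards from \<open>s\<close>, the value cannot drop below
    \<open>l\<close>: a maximum over \<open>{t..s}\<close> would be at least \<open>l\<close> and
    lie to the right of \<open>t\<close>, and the negative derivative there would give larger values
    on its left.\<close>
  have above: "l \<le> f t" if "t \<le> s" for t
  proof (rule ccontr)
    assume t: "\<not> l \<le> f t"
    have "continuous_on {t..s} f"
      using DERIV_isCont[OF deriv] by (auto intro: continuous_at_imp_continuous_on)
    then obtain u where u: "u \<in> {t..s}" "\<And>r. r \<in> {t..s} \<Longrightarrow> f r \<le> f u"
      using continuous_attains_sup[of "{t..s}" f] \<open>t \<le> s\<close> by auto
    have "l \<le> f u"
      using fs u(2)[of s] \<open>t \<le> s\<close> by simp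
    with t u(1) have "t < u"
      by (cases "t = u") auto
    have "f' u < 0"
      using decr[of u] \<open>l \<le> f u\<close> u(1) \<open>s \<le> s1\<close> by auto
    then obtain d where d: "0 < d" "\<And>h. 0 < h \<Longrightarrow> h < d \<Longrightarrow> f u < f (u - h)"
      using DERIV_neg_dec_left[OF deriv] by blast
    define h where "h = min (d / 2) (u - t)"
    have "f u < f (u - h)"
      using d \<open>t < u\<close> by (intro d(2)) (auto simp: h_def)
    moreover have "f (u - h) \<le> f u"
      using u(1) \<open>0 < d\<close> \<open>t < u\<close> by (intro u(2)) (auto simp: h_def)
    ultimately show False by simp
  qed
  \<comment> \<open>So far back that growth at unit rate from a value of at least \<open>l\<close>
    exceeds \<open>A\<close>.\<close>
  define t where "t = s - (\<bar>A\<bar> + \<bar>l\<bar> + 1)"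
  have "t < s" by (simp add: t_def)
  have "\<exists>z>t. z < s \<and> f s - f t = (s - t) * f' z"
    using MVT2[OF \<open>t < s\<close> deriv] by blast
  then obtain z where z: "t < z" "z < s" "f s - f t = (s - t) * f' z" by blast
  have "(s - t) * f' z \<le> (s - t) * (- 1)"
    using z decr[of z] above[of z] \<open>s \<le> s1\<close> by (intro mult_left_mono) auto
  with z have "f s + (s - t) \<le> f t" by (simp add: algebra_simps)
  moreover have "f t \<le> A"
    using \<open>t < s\<close> \<open>s \<le> s1\<close> by (intro bound) simp
  ultimately show False
    using fs by (simp add: t_def)
qed

lemma tendsto_exp_at_bot:
  fixes r :: real
  assumes "0 < r"
  shows "((\<lambda>s. exp (r * s)) \<longlongrightarrow> 0) at_bot"
  by (rule filterlim_compose[OF exp_at_bot])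
    (rule filterlim_tendsto_pos_mult_at_bot[OF tendsto_const assms filterlim_ident])

lemma filterlim_exp_minus_at_bot:
  fixes r :: real
  assumes "0 < r"
  shows "filterlim (\<lambda>s. exp (- r * s)) at_top at_bot"
proof -
  have "filterlim (\<lambda>s. - r * s) at_top at_bot"
    using filterlim_tendsto_pos_mult_at_top[OF tendsto_const assms filterlim_uminus_at_top_at_bot]
    by simp
  then show ?thesis
    by (rule filterlim_compose[OF exp_at_top])
qed

context cooperative
begin

lemma p_nonzero [simp]: "p \<noteq> 0"
  using p by simp

lemma p_gt: "c / p < c"
  using c p by (simp add: field_simps)

text \<open>The supersolution is \<open>A (exp (-c s / p) + exp (\<rho> s))\<close>: the first term matches the
  expected blow-up at \<open>-\<infinity>\<close>, and for large \<open>\<rho>\<close> the second makes it a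
  supersolution of the linear part on \<open>s \<ge> 0\<close>.\<close>

lemma supersolution_exists:
  obtains A \<rho> where "0 < A" "0 < \<rho>"
    "supersolution c \<kappa> \<beta> p
      (\<lambda>s. A * (exp (- (c / p) * s) + exp (\<rho> * s)))
      (\<lambda>s. A * (- (c / p) * exp (- (c / p) * s) + \<rho> * exp (\<rho> * s)))
      (\<lambda>s. \<kappa> * A * (exp ((c - c / p) * s) / (c - c / p) + exp ((c + \<rho>) * s) / (c + \<rho>)))
      (\<lambda>s. \<kappa> * A * (exp ((c - c / p) * s) + exp ((c + \<rho>) * s)))"
proof -
  define \<epsilon> where "\<epsilon> = c - c / p"
  have \<epsilon>: "0 < \<epsilon>" using p_gt by (simp add: \<epsilon>_def)
  \<comment> \<open>\<open>Q\<close> is the coefficient of \<open>A * exp (- (c / p) * s)\<close> to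
    be absorbed: linear term, derivative of the supersolution, and nonlocal term.\<close>
  define Q where "Q = c + c / p + \<kappa> / \<epsilon>"
  have Q: "0 < Q" using c p \<kappa> \<epsilon> by (simp add: Q_def add_pos_pos)
  \<comment> \<open>Large enough that the coefficient left for \<open>exp (\<rho> * s)\<close>,
    after its own linear and nonlocal contributions, is still at least \<open>Q\<close>.\<close>
  define \<rho> where "\<rho> = c + Q + \<kappa> / c"
  have \<rho>: "0 < \<rho>" using c \<kappa> Q by (simp add: \<rho>_def add_pos_pos)
  have "\<kappa> / (c + \<rho>) \<le> \<kappa> / c"
    using c \<rho> \<kappa> by (intro divide_left_mono) auto
  then have \<rho>_ge: "Q \<le> \<rho> - c - \<kappa> / (c + \<rho>)"
    by (simp add: \<rho>_def)
  \<comment> \<open>\<open>\<beta> * A powr (p - 1) \<ge> Q + 1\<close> lets the power term absorb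
    \<open>A * Q\<close> and also the constant 1 in front of \<open>exp (- c * s)\<close>; the
    latter uses \<open>A \<ge> 1\<close>.\<close>
  define A where "A = max 1 (((Q + 1) / \<beta>) powr (1 / (p - 1)))"
  have A: "1 \<le> A" by (simp add: A_def)
  have "(((Q + 1) / \<beta>) powr (1 / (p - 1))) powr (p - 1) \<le> A powr (p - 1)"
    using p by (intro powr_mono2) (auto simp: A_def)
  then have "Q + 1 \<le> \<beta> * A powr (p - 1)"
    using p Q \<beta> by (simp add: powr_powr field_simps)
  then have "A * (Q + 1) \<le> A * (\<beta> * A powr (p - 1))"
    using A by (intro mult_left_mono) auto
  also have "\<dots> = \<beta> * A powr p"
    using A powr_mult_base[of A "p - 1"] by simp
  finally have A_ge: "A * Q \<le> \<beta> * A powr p - 1"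
    using A by (simp add: algebra_simps)
  have "supersolution c \<kappa> \<beta> p
      (\<lambda>s. A * (exp (- (c / p) * s) + exp (\<rho> * s)))
      (\<lambda>s. A * (- (c / p) * exp (- (c / p) * s) + \<rho> * exp (\<rho> * s)))
      (\<lambda>s. \<kappa> * A * (exp (\<epsilon> * s) / \<epsilon> + exp ((c + \<rho>) * s) / (c + \<rho>)))
      (\<lambda>s. \<kappa> * A * (exp (\<epsilon> * s) + exp ((c + \<rho>) * s)))"
  proof
    fix s
    define E where "E = exp (- (c / p) * s)"
    define L where "L = exp (\<rho> * s)"
    have E: "0 < E" and L: "0 < L" by (simp_all add: E_def L_def)
    show "0 < A * (exp (- (c / p) * s) + exp (\<rho> * s))"
      using A by (intro mult_pos_pos add_pos_pos) auto
    show "0 \<le> \<kappa> * A * (exp (\<epsilon> * s) / \<epsilon> + exp ((c + \<rho>) * s) / (c + \<rho>))"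
      using A \<kappa> \<epsilon> c \<rho> by simp
    show "((\<lambda>s. A * (exp (- (c / p) * s) + exp (\<rho> * s))) has_real_derivative
        A * (- (c / p) * exp (- (c / p) * s) + \<rho> * exp (\<rho> * s))) (at s)"
      by (auto intro!: derivative_eq_intros)
    show "((\<lambda>s. \<kappa> * A * (exp (\<epsilon> * s) / \<epsilon> + exp ((c + \<rho>) * s) / (c + \<rho>))) has_real_derivative
        \<kappa> * A * (exp (\<epsilon> * s) + exp ((c + \<rho>) * s))) (at s)"
      using \<epsilon> c \<rho> by (auto intro!: derivative_eq_intros)
    have cE: "exp (c * s) * E = exp (\<epsilon> * s)" and cL: "exp (c * s) * L = exp ((c + \<rho>) * s)"
      by (simp_all add: E_def L_def \<epsilon>_def algebra_simps flip: exp_add)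
    show "\<kappa> * (exp (c * s) * (A * (exp (- (c / p) * s) + exp (\<rho> * s))))
        \<le> \<kappa> * A * (exp (\<epsilon> * s) + exp ((c + \<rho>) * s))"
      unfolding E_def[symmetric] L_def[symmetric] cE[symmetric] cL[symmetric]
      by (simp add: algebra_simps)
    have eE: "exp (- c * s) * exp (\<epsilon> * s) = E"
        "exp (- c * s) * exp ((c + \<rho>) * s) = L"
      by (simp_all add: E_def L_def \<epsilon>_def algebra_simps flip: exp_add)
    have H: "exp (- c * s) * (1 + \<kappa> * A * (exp (\<epsilon> * s) / \<epsilon> + exp ((c + \<rho>) * s) / (c + \<rho>)))
        = exp (- c * s) + \<kappa> * A * (E / \<epsilon> + L / (c + \<rho>))"
      unfolding eE[symmetric] by (simp add: algebra_simps)
    have pE: "(A * E) powr p = A powr p * exp (- c * s)"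
      using A p by (simp add: powr_mult E_def exp_powr_real)
    have "(A * E) powr p \<le> (A * (E + L)) powr p"
      using A E L p by (intro powr_mono2) auto
    then have "A powr p * exp (- c * s) \<le> (A * (E + L)) powr p"
      by (simp add: pE)
    then have pw: "\<beta> * (A powr p * exp (- c * s)) \<le> \<beta> * (A * (E + L)) powr p"
      using \<beta> by (intro mult_left_mono) auto
    have AQ: "0 \<le> A * Q" using A Q by simp
    \<comment> \<open>For \<open>s \<le> 0\<close> the power term absorbs the left side because
      \<open>E \<le> exp (- c * s)\<close>; for \<open>s > 0\<close> the growing exponential does,
      because \<open>E \<le> 1 \<le> L\<close>. The other term on the right is nonnegative in either
      case.\<close>
    have main: "A * Q * E \<le> (\<beta> * A powr p - 1) * exp (- c * s) + A * (\<rho> - c - \<kappa> / (c + \<rho>)) * L"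
    proof (cases "s \<le> 0")
      case True
      have "c * s \<le> c / p * s"
        using True p_gt by (intro mult_right_mono_neg) auto
      then have "E \<le> exp (- c * s)" by (simp add: E_def)
      then have "A * Q * E \<le> (\<beta> * A powr p - 1) * exp (- c * s)"
        using A_ge AQ E by (intro mult_mono) auto
      moreover have "0 \<le> A * (\<rho> - c - \<kappa> / (c + \<rho>)) * L"
        using A \<rho>_ge Q L by simp
      ultimately show ?thesis by linarith
    next
      case False
      have "E \<le> 1" "1 \<le> L"
        using False c p \<rho> by (auto simp: E_def L_def)
      then have "A * Q * E \<le> A * (\<rho> - c - \<kappa> / (c + \<rho>)) * L"
        using A \<rho>_ge Q E by (intro mult_mono) auto
      moreover have "0 \<le> (\<beta> * A powr p - 1) * exp (- c * s)"
        using A_ge AQ by simp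
      ultimately show ?thesis by linarith
    qed
    have "exp (- c * s) + \<kappa> * A * (E / \<epsilon> + L / (c + \<rho>)) + c * (A * (E + L)) - \<beta> * (A * (E + L)) powr p
        \<le> A * (- (c / p) * E + \<rho> * L)"
      using main pw by (simp add: Q_def algebra_simps)
    then show "exp (- c * s) * (1 + \<kappa> * A * (exp (\<epsilon> * s) / \<epsilon> + exp ((c + \<rho>) * s) / (c + \<rho>))) +
        c * (A * (exp (- (c / p) * s) + exp (\<rho> * s))) -
        \<beta> * (A * (exp (- (c / p) * s) + exp (\<rho> * s))) powr p
        \<le> A * (- (c / p) * exp (- (c / p) * s) + \<rho> * exp (\<rho> * s))"
      unfolding H unfolding E_def L_def .
  qed
  then show thesis
    using that[of A \<rho>] A \<rho> by (simp add: \<epsilon>_def)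
qed

lemma singular_solution_exists:
  obtains v e where "solution v e"
    "((\<lambda>s. \<beta> * v s powr p * exp (c * s)) \<longlongrightarrow> 1) at_bot"
proof -
  obtain A \<rho> where A: "0 < A" "0 < \<rho>" and super: "supersolution c \<kappa> \<beta> p
      (\<lambda>s. A * (exp (- (c / p) * s) + exp (\<rho> * s)))
      (\<lambda>s. A * (- (c / p) * exp (- (c / p) * s) + \<rho> * exp (\<rho> * s)))
      (\<lambda>s. \<kappa> * A * (exp ((c - c / p) * s) / (c - c / p) + exp ((c + \<rho>) * s) / (c + \<rho>)))
      (\<lambda>s. \<kappa> * A * (exp ((c - c / p) * s) + exp ((c + \<rho>) * s)))"
    by (rule supersolution_exists)
  interpret supersolution c \<kappa> \<beta> p
      "\<lambda>s. A * (exp (- (c / p) * s) + exp (\<rho> * s))"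
      "\<lambda>s. A * (- (c / p) * exp (- (c / p) * s) + \<rho> * exp (\<rho> * s))"
      "\<lambda>s. \<kappa> * A * (exp ((c - c / p) * s) / (c - c / p) + exp ((c + \<rho>) * s) / (c + \<rho>))"
      "\<lambda>s. \<kappa> * A * (exp ((c - c / p) * s) + exp ((c + \<rho>) * s))"
    by (rule super)
  obtain v where v: "solution v (\<lambda>s. exp (- c * s) * X v s)" "admissible v"
    by (rule solution_exists)
  define \<epsilon> where "\<epsilon> = c - c / p"
  have \<epsilon>: "0 < \<epsilon>" using p_gt by (simp add: \<epsilon>_def)
  have vpos: "0 < v s" for s
    using v(1) by (simp add: solution_def)
  \<comment> \<open>Both exponents in the majorant of the nonlocal term are positive, so it vanishes
    at \<open>-\<infinity>\<close> and \<open>X v\<close> is squeezed to 1.\<close>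
  have "((\<lambda>s. 1 + \<kappa> * A * (exp (\<epsilon> * s) / \<epsilon> + exp ((c + \<rho>) * s) / (c + \<rho>))) \<longlongrightarrow>
      1 + \<kappa> * A * (0 / \<epsilon> + 0 / (c + \<rho>))) at_bot"
    using \<epsilon> c A by (intro tendsto_intros tendsto_exp_at_bot) auto
  then have H_lim: "((\<lambda>s. 1 + \<kappa> * A * (exp (\<epsilon> * s) / \<epsilon> + exp ((c + \<rho>) * s) / (c + \<rho>))) \<longlongrightarrow> 1) at_bot"
    by simp
  have X_lim: "(X v \<longlongrightarrow> 1) at_bot"
    by (rule tendsto_sandwich[OF _ _ tendsto_const H_lim])
      (use X_bounds[OF v(2)] in \<open>auto simp: \<epsilon>_def\<close>)
  \<comment> \<open>Since \<open>W\<close> is bounded and \<open>W' \<approx> exp (- \<epsilon> s) (1 - \<beta> W powr p)\<close>, any fixed deviation of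
    \<open>\<beta> W powr p\<close> from 1 would drive \<open>W\<close> out of \<open>{0..2 A}\<close> backwards in time.\<close>
  define W where "W s = v s * exp (c / p * s)" for s
  define Q where "Q = c + c / p"
  have Q: "0 < Q" using c p by (simp add: Q_def add_pos_pos)
  have Wpos: "0 < W s" for s
    using vpos by (simp add: W_def)
  have Wp: "W s powr p = v s powr p * exp (c * s)" for s
    using p vpos[of s] by (simp add: W_def powr_mult exp_powr_real less_imp_le)
  define W' where "W' s = exp (- \<epsilon> * s) * (X v s - \<beta> * W s powr p) + Q * W s" for s
  have dW: "(W has_real_derivative W' s) (at s)" for s
  proof -
    have "(v has_real_derivative exp (- c * s) * X v s + c * v s - \<beta> * v s powr p) (at s)"
      using v(1) by (simp add: solution_def)
    then have d: "(W has_real_derivative v s * (exp (c / p * s) * (c / p)) +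
        (exp (- c * s) * X v s + c * v s - \<beta> * v s powr p) * exp (c / p * s)) (at s)"
      unfolding W_def by (auto intro!: derivative_eq_intros)
    have "exp (- \<epsilon> * s) = exp (- c * s) * exp (c / p * s)"
      by (simp add: \<epsilon>_def algebra_simps flip: exp_add)
    moreover have "exp (- c * s) * (exp (c / p * s) * W s powr p) = exp (c / p * s) * v s powr p"
      by (simp add: Wp flip: exp_add)
    ultimately have "v s * (exp (c / p * s) * (c / p)) +
        (exp (- c * s) * X v s + c * v s - \<beta> * v s powr p) * exp (c / p * s) = W' s"
      unfolding W'_def Q_def by (simp only: W_def[of s]) (simp only: algebra_simps)
    with d show ?thesis by simp
  qed
  have W_le: "W s \<le> 2 * A" if "s \<le> 0" for s
  proof -
    have "(c / p + \<rho>) * s \<le> 0"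
      using that c p A by (intro mult_nonneg_nonpos) auto
    then have "c / p * s + \<rho> * s \<le> 0"
      by (simp add: algebra_simps)
    have "W s \<le> A * (exp (- (c / p) * s) + exp (\<rho> * s)) * exp (c / p * s)"
      unfolding W_def using v(2)[unfolded admissible_def] by (intro mult_right_mono) auto
    also have "\<dots> = A * (1 + exp (c / p * s + \<rho> * s))"
      by (simp add: algebra_simps flip: exp_add)
    also have "\<dots> \<le> A * (1 + 1)"
      using A \<open>c / p * s + \<rho> * s \<le> 0\<close> by (intro mult_left_mono add_mono) auto
    finally show ?thesis by simp
  qed
  have root: "(W s powr p < r / \<beta>) \<longleftrightarrow> W s < (r / \<beta>) powr (1 / p)" if "0 < r" for r s
  proof -
    have "r / \<beta> = ((r / \<beta>) powr (1 / p)) powr p"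
      using p that \<beta> by (simp add: powr_powr)
    then show ?thesis
      using p Wpos[of s] by (metis powr_less_mono2 powr_mono2 powr_ge_zero less_imp_le
          linorder_not_less less_trans zero_less_one)
  qed
  have "((\<lambda>s. \<beta> * W s powr p) \<longlongrightarrow> 1) at_bot"
  proof (rule order_tendstoI)
    fix r :: real assume r: "1 < r"
    define \<eta> where "\<eta> = (r - 1) / 2"
    have \<eta>: "0 < \<eta>" using r by (simp add: \<eta>_def)
    have "\<forall>\<^sub>F s in at_bot. X v s < 1 + \<eta>"
      using order_tendstoD(2)[OF X_lim, of "1 + \<eta>"] \<eta> by simp
    \<comment> \<open>Past this threshold the singular term outweighs
      \<open>Q * W s \<le> Q * (2 * A)\<close> by at least 1, the unit rate required for backward
      growth.\<close>
    moreover have "\<forall>\<^sub>F s in at_bot. (Q * (2 * A) + 1) / \<eta> \<le> exp (- \<epsilon> * s)"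
      using filterlim_exp_minus_at_bot[OF \<epsilon>] by (simp add: filterlim_at_top)
    ultimately have "\<forall>\<^sub>F s in at_bot. X v s < 1 + \<eta> \<and> (Q * (2 * A) + 1) / \<eta> \<le> exp (- \<epsilon> * s) \<and> s \<le> 0"
      using eventually_le_at_bot[of 0] by eventually_elim auto
    then obtain s1 where s1: "\<And>s. s \<le> s1 \<Longrightarrow>
        X v s < 1 + \<eta> \<and> (Q * (2 * A) + 1) / \<eta> \<le> exp (- \<epsilon> * s) \<and> s \<le> 0"
      unfolding eventually_at_bot_linorder by blast
    have "W s < (r / \<beta>) powr (1 / p)" if "s \<le> s1" for s
    proof (rule less_of_backward_growth[OF dW, of s1 _ "2 * A"])
      fix t assume t: "t \<le> s1" "(r / \<beta>) powr (1 / p) \<le> W t"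
      then have "r / \<beta> \<le> W t powr p"
        using root[of r t] r by simp
      then have "r \<le> \<beta> * W t powr p"
        using \<beta> by (simp add: field_simps)
      then have "X v t - \<beta> * W t powr p \<le> - \<eta>"
        using conjunct1[OF s1[OF t(1)]] by (simp add: \<eta>_def field_simps)
      then have "exp (- \<epsilon> * t) * (X v t - \<beta> * W t powr p) \<le> exp (- \<epsilon> * t) * (- \<eta>)"
        by (intro mult_left_mono) auto
      moreover have "Q * (2 * A) + 1 \<le> exp (- \<epsilon> * t) * \<eta>"
        using s1[OF t(1)] \<eta> by (simp add: field_simps)
      moreover have "Q * W t \<le> Q * (2 * A)"
        using W_le[of t] s1[OF t(1)] Q by simp
      ultimately show "W' t \<le> - 1"
        by (simp add: W'_def)
    qed (use W_le s1 that in auto)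
    then have "\<beta> * W s powr p < r" if "s \<le> s1" for s
      using root[of r s] r that \<beta> by (simp add: field_simps)
    then show "\<forall>\<^sub>F s in at_bot. \<beta> * W s powr p < r"
      unfolding eventually_at_bot_linorder by blast
  next
    fix r :: real assume r: "r < 1"
    \<comment> \<open>A level strictly between \<open>r\<close> and 1 that is positive even if
      \<open>r\<close> is not, so that its root can be compared with \<open>W\<close>. On this side
      \<open>X v \<ge> 1\<close> and \<open>W > 0\<close> already suffice, with lower bound 0 for
      \<open>W\<close> in place of \<open>2 * A\<close>.\<close>
    define q where "q = (max r 0 + 1) / 2"
    have q: "0 < q" "q < 1" "r < q" using r by (auto simp: q_def)
    have "\<forall>\<^sub>F s in at_bot. 1 / (1 - q) \<le> exp (- \<epsilon> * s)"
      using filterlim_exp_minus_at_bot[OF \<epsilon>] by (simp add: filterlim_at_top)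
    then obtain s1 where s1: "\<And>s. s \<le> s1 \<Longrightarrow> 1 / (1 - q) \<le> exp (- \<epsilon> * s)"
      unfolding eventually_at_bot_linorder by blast
    have "- W s < - ((q / \<beta>) powr (1 / p))" if "s \<le> s1" for s
    proof (rule less_of_backward_growth[OF DERIV_minus[OF dW], of s1 _ 0])
      fix t assume t: "t \<le> s1" "- ((q / \<beta>) powr (1 / p)) \<le> - W t"
      have "W t powr p \<le> ((q / \<beta>) powr (1 / p)) powr p"
        using t(2) Wpos[of t] p by (intro powr_mono2) auto
      then have "\<beta> * W t powr p \<le> q"
        using \<beta> p q by (simp add: powr_powr field_simps)
      then have "1 - q \<le> X v t - \<beta> * W t powr p"
        using X_bounds(1)[OF v(2), of t] by simp
      then have "exp (- \<epsilon> * t) * (1 - q) \<le> exp (- \<epsilon> * t) * (X v t - \<beta> * W t powr p)"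
        by (intro mult_left_mono) auto
      moreover have "1 \<le> exp (- \<epsilon> * t) * (1 - q)"
        using s1[OF t(1)] q by (simp add: field_simps)
      moreover have "0 \<le> Q * W t"
        using Q Wpos[of t] by simp
      ultimately show "- W' t \<le> - 1"
        unfolding W'_def by linarith
    qed (use Wpos that in \<open>auto simp: less_imp_le\<close>)
    then have "\<not> W s powr p < q / \<beta>" if "s \<le> s1" for s
      using root[of q s] q that by fastforce
    then have "r < \<beta> * W s powr p" if "s \<le> s1" for s
      using q that \<beta> by (force simp: field_simps)
    then show "\<forall>\<^sub>F s in at_bot. r < \<beta> * W s powr p"
      unfolding eventually_at_bot_linorder by blast
  qed
  then have "((\<lambda>s. \<beta> * v s powr p * exp (c * s)) \<longlongrightarrow> 1) at_bot"
    by (simp add: Wp mult.assoc)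
  with v(1) show thesis
    by (rule that)
qed

end

section \<open>Behaviour at infinity\<close>

lemma gronwall_mono:
  fixes f f' G S :: "real \<Rightarrow> real"
  assumes "\<And>s. (G has_real_derivative S s) (at s)"
    and "\<And>s. (f has_real_derivative f' s) (at s)"
    and "\<And>s. s0 \<le> s \<Longrightarrow> s \<le> s1 \<Longrightarrow> S s * f s \<le> f' s" and "s0 \<le> s1"
  shows "f s0 * exp (- G s0) \<le> f s1 * exp (- G s1)"
proof (rule DERIV_nonneg_imp_nondecreasing[OF \<open>s0 \<le> s1\<close>])
  fix s assume s: "s0 \<le> s" "s \<le> s1"
  have "((\<lambda>s. f s * exp (- G s)) has_real_derivative (f' s - S s * f s) * exp (- G s)) (at s)"
    by (auto intro!: derivative_eq_intros assms(1,2) simp: algebra_simps)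
  moreover have "0 \<le> (f' s - S s * f s) * exp (- G s)"
    using assms(3)[OF s] by simp
  ultimately show "\<exists>y. ((\<lambda>s. f s * exp (- G s)) has_real_derivative y) (at s) \<and> 0 \<le> y"
    by blast
qed

lemma linear_inequality_pos:
  fixes f f' S :: "real \<Rightarrow> real"
  assumes "continuous_on UNIV S"
    and "\<And>s. (f has_real_derivative f' s) (at s)"
    and "\<And>s. s0 \<le> s \<Longrightarrow> s \<le> s1 \<Longrightarrow> S s * f s \<le> f' s" and "s0 \<le> s1" "0 < f s0"
  shows "0 < f s1"
proof -
  obtain G where "\<And>s. (G has_real_derivative S s) (at s)"
    using antiderivative_exists[OF assms(1)] by blast
  from gronwall_mono[OF this assms(2-4)] have "f s0 * exp (- G s0) \<le> f s1 * exp (- G s1)" .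
  moreover have "0 < f s0 * exp (- G s0)" using assms(5) by simp
  ultimately have "0 < f s1 * exp (- G s1)" by linarith
  then show ?thesis by (simp add: zero_less_mult_iff)
qed

lemma linear_inequality_pos_backward:
  fixes f f' S :: "real \<Rightarrow> real"
  assumes "continuous_on UNIV S"
    and "\<And>s. (f has_real_derivative f' s) (at s)"
    and "\<And>s. f' s \<le> S s * f s" and "s0 \<le> s1" "0 < f s1"
  shows "0 < f s0"
proof -
  obtain G where "\<And>s. (G has_real_derivative S s) (at s)"
    using antiderivative_exists[OF assms(1)] by blast
  from gronwall_mono[OF this DERIV_minus[OF assms(2)] _ assms(4)] assms(3)
  have "f s1 * exp (- G s1) \<le> f s0 * exp (- G s0)" by simp
  moreover have "0 < f s1 * exp (- G s1)" using assms(5) by simp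
  ultimately have "0 < f s0 * exp (- G s0)" by linarith
  then show ?thesis by (simp add: zero_less_mult_iff)
qed

lemma mono_bounded_tendsto_at_top:
  fixes f :: "real \<Rightarrow> real"
  assumes mono: "\<And>s t. s \<le> t \<Longrightarrow> f s \<le> f t" and bound: "\<And>s. f s \<le> M"
  obtains L where "(f \<longlongrightarrow> L) at_top"
proof -
  have bdd: "bdd_above (range f)"
    using bound by (auto simp: bdd_above_def)
  have "(f \<longlongrightarrow> Sup (range f)) at_top"
  proof (rule order_tendstoI)
    fix r assume "r < Sup (range f)"
    then obtain s where "r < f s"
      using less_cSup_iff[OF _ bdd] by auto
    then show "\<forall>\<^sub>F t in at_top. r < f t"
      unfolding eventually_at_top_linorder using mono less_le_trans by blast
  next
    fix r assume "Sup (range f) < r"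
    then show "\<forall>\<^sub>F t in at_top. f t < r"
      using cSup_upper[OF _ bdd] by (intro always_eventually) (meson le_less_trans rangeI)
  qed
  then show thesis by (rule that)
qed

lemma DERIV_powr_logarithmic:
  fixes v :: "real \<Rightarrow> real"
  assumes "(v has_real_derivative r * v s) (at s)" "0 < v s"
  shows "((\<lambda>s. v s powr q) has_real_derivative q * r * v s powr q) (at s)"
proof -
  have "((\<lambda>s. v s powr q) has_real_derivative (q * v s powr (q - 1)) * (r * v s)) (at s)"
    using DERIV_chain2[OF has_real_derivative_powr[OF assms(2)] assms(1)] .
  moreover have "(q * v s powr (q - 1)) * (r * v s) = q * r * v s powr q"
    using assms(2) powr_mult_base[of "v s" "q - 1"] by (simp add: mult.commute mult.left_commute)
  ultimately show ?thesis by simp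
qed

text \<open>\<open>b\<close> is the value of \<open>\<beta> * v powr (p - 1)\<close> at the constant
  solution. The quadratic for \<open>k\<close> is the eigenvector condition for
  \<open>\<theta> = k * (x - 1)\<close> in the linearisation there, with eigenvalue
  \<open>- (p - 1) * k\<close>; the bound \<open>k < a\<close> selects the slow direction.\<close>

locale profile_equation = cooperative +
  fixes a b k :: real
  assumes a: "0 < a" and \<kappa>_eq: "\<kappa> = a\<^sup>2 - c\<^sup>2" and cb: "c * b = a\<^sup>2"
    and k_root: "(p - 1) * k\<^sup>2 - p * b * k + a\<^sup>2 = 0" and k: "0 < k" "k < a"
begin

lemma a_less_b: "a < b"
proof -
  have "c\<^sup>2 < a\<^sup>2" using \<kappa> \<kappa>_eq by simp
  then have "c < a" using a power2_less_imp_less by force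
  then have "c * a < c * b" using a by (simp add: cb power2_eq_square)
  then show ?thesis using c by simp
qed

lemma b: "0 < b"
  using a a_less_b by simp

text \<open>The other root of the quadratic, read off from the sum of the roots.\<close>

definition k2 :: real where
  "k2 = p * b / (p - 1) - k"

lemma k_k2: "(p - 1) * (k + k2) = p * b" "(p - 1) * (k * k2) = a\<^sup>2"
proof -
  show *: "(p - 1) * (k + k2) = p * b"
    using p by (simp add: k2_def)
  have "(p - 1) * (k * k2) = ((p - 1) * (k + k2)) * k - (p - 1) * k\<^sup>2"
    by (simp add: algebra_simps power2_eq_square)
  then show "(p - 1) * (k * k2) = a\<^sup>2"
    using k_root by (simp add: *)
qed

text \<open>The quadratic takes the negative value \<open>p * a * (a - b)\<close> at
  \<open>a\<close>, so \<open>a\<close> separates the roots, and \<open>k < a\<close> makes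
  \<open>k\<close> the smaller one.\<close>

lemma k_less_k2: "k < k2"
proof -
  have "(p - 1) * ((a - k) * (a - k2)) =
      (p - 1) * a\<^sup>2 - ((p - 1) * (k + k2)) * a + (p - 1) * (k * k2)"
    by (simp add: algebra_simps power2_eq_square)
  also have "\<dots> = p * a * (a - b)"
    unfolding k_k2 by (simp add: algebra_simps power2_eq_square)
  also have "\<dots> < 0"
    using p a a_less_b by (intro mult_pos_neg) auto
  finally have "(a - k) * (a - k2) < 0"
    using p by (simp add: mult_less_0_iff)
  then show ?thesis
    using k by (simp add: mult_less_0_iff)
qed

text \<open>Raised to the power \<open>(p - 1) / p\<close>, the hypothesis says that
  \<open>v powr (p - 1)\<close> behaves like a positive multiple of a decreasing
  exponential.\<close>

lemma x_to_limit:
  assumes "((\<lambda>s. \<beta> * v s powr p * exp (c * s)) \<longlongrightarrow> 1) at_bot" "\<And>s. 0 < v s"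
  shows "filterlim (\<lambda>s. \<beta> / b * v s powr (p - 1)) at_top at_bot"
proof -
  define q where "q = (p - 1) / p"
  have "((\<lambda>s. (\<beta> * v s powr p * exp (c * s)) powr q) \<longlongrightarrow> 1 powr q) at_bot"
    by (intro tendsto_intros assms) auto
  moreover have "(\<beta> * v s powr p * exp (c * s)) powr q =
      \<beta> powr q * (v s powr (p - 1)) * exp (c * q * s)" for s
    using \<beta> p assms(2)[of s]
    by (simp add: powr_mult powr_powr exp_powr_real q_def less_imp_le mult_ac)
  ultimately have "((\<lambda>s. \<beta> / b * \<beta> powr - q * (\<beta> powr q * (v s powr (p - 1)) * exp (c * q * s))) \<longlongrightarrow>
      \<beta> / b * \<beta> powr - q * 1) at_bot"
    by (intro tendsto_intros) auto
  moreover have "0 < \<beta> / b * \<beta> powr - q * 1"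
    using \<beta> b by simp
  moreover have "filterlim (\<lambda>s. exp (- (c * q) * s)) at_top at_bot"
    using c p by (intro filterlim_exp_minus_at_bot) (auto simp: q_def)
  ultimately have "filterlim (\<lambda>s. \<beta> / b * \<beta> powr - q * (\<beta> powr q * (v s powr (p - 1)) * exp (c * q * s))
      * exp (- (c * q) * s)) at_top at_bot"
    by (rule filterlim_tendsto_pos_mult_at_top)
  moreover have eq: "\<beta> / b * \<beta> powr - q * (\<beta> powr q * (v s powr (p - 1)) * exp (c * q * s))
      * exp (- (c * q) * s) = \<beta> / b * v s powr (p - 1)" for s
  proof -
    have "\<beta> powr - q * \<beta> powr q = 1" "exp (c * q * s) * exp (- (c * q) * s) = 1"
      using \<beta> by (simp_all flip: powr_add exp_add)
    then show ?thesis
      by (metis (no_types, opaque_lifting) mult.assoc mult.left_commute mult.right_neutral)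
  qed
  ultimately show ?thesis
    unfolding eq by simp
qed

end

section \<open>Phase-plane analysis of a singular solution\<close>

locale singular_solution = profile_equation +
  fixes v e :: "real \<Rightarrow> real"
  assumes sol: "solution v e"
    and singular: "((\<lambda>s. \<beta> * v s powr p * exp (c * s)) \<longlongrightarrow> 1) at_bot"
begin

text \<open>In the variables \<open>x\<close>, \<open>\<theta> = - v' / v\<close> the equation becomes a quadratic planar
  system; the constant solution is the equilibrium \<open>(1, 0)\<close>, and the line
  \<open>\<theta> = k (x - 1)\<close> is tangent to its slow eigendirection.\<close>

definition x :: "real \<Rightarrow> real" where
  "x s = \<beta> / b * v s powr (p - 1)"

definition \<theta> :: "real \<Rightarrow> real" where
  "\<theta> s = b * x s - c - e s / v s"

lemma v_pos: "0 < v s"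
  using sol by (simp add: solution_def)

lemma x_pos: "0 < x s"
  using v_pos[of s] \<beta> b by (simp add: x_def)

lemma v_deriv: "(v has_real_derivative - \<theta> s * v s) (at s)"
proof -
  have "(v has_real_derivative e s + c * v s - \<beta> * v s powr p) (at s)"
    using sol by (simp add: solution_def)
  moreover have "v s powr p = v s * v s powr (p - 1)"
    using v_pos[of s] powr_mult_base[of "v s" "p - 1"] by simp
  then have "e s + c * v s - \<beta> * v s powr p = - \<theta> s * v s"
    using v_pos[of s] b by (simp add: \<theta>_def x_def field_simps)
  ultimately show ?thesis by simp
qed

lemma x_deriv: "(x has_real_derivative - ((p - 1) * x s * \<theta> s)) (at s)"
  unfolding x_def using DERIV_cmult[OF DERIV_powr_logarithmic[OF v_deriv v_pos]]
  by (rule DERIV_cong) (simp add: diff_divide_distrib algebra_simps)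

lemma \<theta>_deriv: "(\<theta> has_real_derivative (\<theta> s)\<^sup>2 - p * b * x s * \<theta> s + a\<^sup>2 * (x s - 1)) (at s)"
proof -
  have e': "(e has_real_derivative \<kappa> * v s - c * e s) (at s)"
    using sol by (simp add: solution_def)
  have "(\<theta> has_real_derivative b * - ((p - 1) * x s * \<theta> s) -
      ((\<kappa> * v s - c * e s) * v s - e s * (- \<theta> s * v s)) / (v s * v s)) (at s)"
    unfolding \<theta>_def[abs_def]
    using v_pos[of s] by (auto intro!: derivative_eq_intros x_deriv v_deriv e' simp: \<theta>_def)
  \<comment> \<open>Eliminating \<open>e s / v s\<close> in favour of \<open>x s\<close> and
    \<open>\<theta> s\<close> closes the planar system.\<close>
  moreover define r where "r = e s / v s"
  have "e s = r * v s" using v_pos[of s] by (simp add: r_def)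
  then have "((\<kappa> * v s - c * e s) * v s - e s * (- \<theta> s * v s)) / (v s * v s) = \<kappa> - c * r + r * \<theta> s"
    using v_pos[of s] by (simp add: field_simps)
  moreover have "r = b * x s - c - \<theta> s"
    by (simp add: \<theta>_def r_def)
  ultimately have "(\<theta> has_real_derivative b * - ((p - 1) * x s * \<theta> s) -
      (\<kappa> - c * (b * x s - c - \<theta> s) + (b * x s - c - \<theta> s) * \<theta> s)) (at s)"
    by simp
  moreover have "b * - ((p - 1) * x s * \<theta> s) -
      (\<kappa> - c * (b * x s - c - \<theta> s) + (b * x s - c - \<theta> s) * \<theta> s) =
      (\<theta> s)\<^sup>2 - p * b * x s * \<theta> s + (c * b) * x s - a\<^sup>2"
    by (simp add: \<kappa>_eq algebra_simps power2_eq_square)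
  ultimately show ?thesis
    unfolding cb by (simp only: right_diff_distrib mult_1_right add_diff_eq)
qed

lemma x_cont: "continuous_on S x" and \<theta>_cont: "continuous_on S \<theta>"
  using DERIV_isCont[OF x_deriv] DERIV_isCont[OF \<theta>_deriv]
  by (auto intro: continuous_at_imp_continuous_on)

lemma x_at_bot: "filterlim x at_top at_bot"
  unfolding x_def[abs_def] using singular v_pos by (rule x_to_limit)

lemma x_large: obtains s0 where "s0 \<le> t" "\<And>s. s \<le> s0 \<Longrightarrow> r \<le> x s"
proof -
  have "\<forall>\<^sub>F s in at_bot. r \<le> x s"
    using x_at_bot by (simp add: filterlim_at_top)
  then obtain s0 where "\<And>s. s \<le> s0 \<Longrightarrow> r \<le> x s"
    by (auto simp: eventually_at_bot_linorder)
  then show thesis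
    using that[of "min s0 t"] by simp
qed

text \<open>A violation persists for all earlier times. Where \<open>x\<close> is large it then
  forces \<open>\<theta> \<ge> k * x / 2\<close>, so \<open>1 / x\<close> decreases backwards at a
  fixed rate and reaches 0 in finite time: \<open>x\<close> would blow up at a finite
  \<open>s\<close>, although the solution exists on the whole line.\<close>

lemma \<theta>_le: "\<theta> s \<le> k * (x s - 1)"
proof (rule ccontr)
  assume neg: "\<not> ?thesis"
  define P where "P s = \<theta> s - k * (x s - 1)" for s
  define S where "S s = \<theta> s + k * (x s - 1) - p * b * x s + k * (p - 1) * x s" for s
  \<comment> \<open>The quadratic for \<open>k\<close> cancels every term that is neither a multiple
    of \<open>P\<close> nor of the sign that lets positivity propagate backwards.\<close>
  have dP: "(P has_real_derivative S s * P s - (a\<^sup>2 - k\<^sup>2) * (x s - 1)\<^sup>2) (at s)" for s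
  proof -
    have "(P has_real_derivative (\<theta> s)\<^sup>2 - p * b * x s * \<theta> s + a\<^sup>2 * (x s - 1)
        + k * ((p - 1) * x s * \<theta> s)) (at s)"
      unfolding P_def by (auto intro!: derivative_eq_intros x_deriv \<theta>_deriv)
    moreover have "(\<theta> s)\<^sup>2 - p * b * x s * \<theta> s + a\<^sup>2 * (x s - 1) + k * ((p - 1) * x s * \<theta> s)
        - (S s * P s - (a\<^sup>2 - k\<^sup>2) * (x s - 1)\<^sup>2) =
        ((p - 1) * k\<^sup>2 - p * b * k + a\<^sup>2) * (x s * (x s - 1))"
      by (simp add: P_def S_def algebra_simps power2_eq_square)
    ultimately show ?thesis
      by (simp add: k_root)
  qed
  have "k\<^sup>2 \<le> a\<^sup>2" using k by (intro power_mono) auto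
  then have "S s * P s - (a\<^sup>2 - k\<^sup>2) * (x s - 1)\<^sup>2 \<le> S s * P s" for s
    by simp
  moreover have "continuous_on UNIV S"
    unfolding S_def by (intro continuous_intros x_cont \<theta>_cont)
  moreover have "0 < P s" using neg by (simp add: P_def)
  ultimately have Ppos: "0 < P t" if "t \<le> s" for t
    using linear_inequality_pos_backward[OF _ dP _ that] by blast
  obtain s0 where s0: "s0 \<le> s" "\<And>t. t \<le> s0 \<Longrightarrow> 2 \<le> x t"
    using x_large by blast
  define d where "d = (p - 1) * k / 2"
  have d: "0 < d" using p k by (simp add: d_def)
  define z where "z s = 1 / x s" for s
  have dz: "(z has_real_derivative (p - 1) * \<theta> s / x s) (at s)" for s
    unfolding z_def using x_pos[of s]
    by (auto intro!: derivative_eq_intros x_deriv simp: field_simps power2_eq_square)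
  have zd: "d \<le> (p - 1) * \<theta> t / x t" if "t \<le> s0" for t
  proof -
    have "k * (x t / 2) \<le> k * (x t - 1)"
      using s0(2)[OF that] k by (intro mult_left_mono) auto
    also have "\<dots> \<le> \<theta> t"
      using Ppos[of t] that s0(1) by (simp add: P_def)
    finally have "(p - 1) * (k * (x t / 2)) \<le> (p - 1) * \<theta> t"
      using p by (intro mult_left_mono) auto
    then show ?thesis
      using x_pos[of t] by (simp add: d_def field_simps)
  qed
  \<comment> \<open>At this time a decrease at rate \<open>d\<close> would have brought
    \<open>z\<close> down to 0.\<close>
  define t where "t = s0 - z s0 / d"
  have t: "t < s0"
    using d x_pos[of s0] by (simp add: t_def z_def)
  have "\<exists>r>t. r < s0 \<and> z s0 - z t = (s0 - t) * ((p - 1) * \<theta> r / x r)"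
    using MVT2[OF t dz] by blast
  then obtain r where r: "r < s0" "z s0 - z t = (s0 - t) * ((p - 1) * \<theta> r / x r)" by blast
  have "(s0 - t) * d \<le> z s0 - z t"
    unfolding r(2) using zd[of r] r t by (intro mult_left_mono) auto
  then have "z t \<le> 0"
    using d by (simp add: t_def)
  then show False
    using x_pos[of t] by (simp add: z_def)
qed

text \<open>By \<open>\<theta>_le\<close>, \<open>x - 1\<close> satisfies a linear differential
  inequality, so it stays positive once it is; it is positive near \<open>-\<infinity>\<close>,
  where \<open>x\<close> is large.\<close>

lemma x_gt_1: "1 < x s"
proof -
  obtain s0 where s0: "s0 \<le> s" "\<And>t. t \<le> s0 \<Longrightarrow> 2 \<le> x t"
    using x_large by blast
  have "0 < x s - 1"
  proof (rule linear_inequality_pos[OF _ _ _ s0(1)])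
    show "((\<lambda>s. x s - 1) has_real_derivative - ((p - 1) * x s * \<theta> s)) (at s)" for s
      by (auto intro!: derivative_eq_intros x_deriv)
    show "- ((p - 1) * x s * k) * (x s - 1) \<le> - ((p - 1) * x s * \<theta> s)" for s
      using mult_left_mono[OF \<theta>_le[of s], of "(p - 1) * x s"] p x_pos[of s] by (simp add: mult.assoc)
    show "continuous_on UNIV (\<lambda>s. - ((p - 1) * x s * k))"
      by (intro continuous_intros x_cont)
    show "0 < x s0 - 1" using s0(2)[of s0] by simp
  qed
  then show ?thesis by simp
qed

text \<open>If \<open>\<theta>\<close> were nonpositive up to \<open>s\<close>, then
  \<open>x\<close> would be nondecreasing there, contradicting its blow-up at
  \<open>-\<infinity>\<close>. From a point with \<open>\<theta> > 0\<close> positivity persists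
  forwards, because \<open>x > 1\<close> gives the remaining term the right sign.\<close>

lemma \<theta>_pos: "0 < \<theta> s"
proof -
  have "\<exists>s0\<le>s. 0 < \<theta> s0"
  proof (rule ccontr)
    assume neg: "\<not> ?thesis"
    obtain s0 where s0: "s0 \<le> s" "\<And>t. t \<le> s0 \<Longrightarrow> x s + 1 \<le> x t"
      using x_large by blast
    have "x s0 \<le> x s"
    proof (rule DERIV_nonneg_imp_nondecreasing[OF s0(1)])
      fix t assume "s0 \<le> t" "t \<le> s"
      with neg have "0 \<le> - ((p - 1) * x t * \<theta> t)"
        using p x_pos[of t] by (auto simp: mult_le_0_iff not_less)
      with x_deriv show "\<exists>y. (x has_real_derivative y) (at t) \<and> 0 \<le> y" by blast
    qed
    with s0(2)[of s0] show False by simp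
  qed
  then obtain s0 where s0: "s0 \<le> s" "0 < \<theta> s0" by blast
  show ?thesis
  proof (rule linear_inequality_pos[OF _ \<theta>_deriv _ s0])
    show "continuous_on UNIV (\<lambda>s. \<theta> s - p * b * x s)"
      by (intro continuous_intros x_cont \<theta>_cont)
    show "(\<theta> s - p * b * x s) * \<theta> s \<le> (\<theta> s)\<^sup>2 - p * b * x s * \<theta> s + a\<^sup>2 * (x s - 1)" for s
    proof -
      have "(\<theta> s - p * b * x s) * \<theta> s = (\<theta> s)\<^sup>2 - p * b * x s * \<theta> s"
        by (simp add: algebra_simps power2_eq_square)
      then show ?thesis
        using x_gt_1[of s] by simp
    qed
  qed
qed

text \<open>Dividing \<open>x - 1\<close> by \<open>x\<close> makes the derivative of
  \<open>H\<close> exactly \<open>(p - 1) * (k - \<omega>)\<close>, which is nonnegative by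
  \<open>\<theta>_le\<close>. It remains to bound \<open>H\<close> above, and the decreasing
  function \<open>K\<close> does this.\<close>

lemma log_deviation_converges:
  obtains L where "((\<lambda>s. ln ((x s - 1) / x s) + (p - 1) * k * s) \<longlongrightarrow> L) at_top"
proof -
  define H where "H s = ln ((x s - 1) / x s) + (p - 1) * k * s" for s
  define \<omega> where "\<omega> s = \<theta> s / (x s - 1)" for s
  \<comment> \<open>The term \<open>- \<omega>\<close> turns the multiple of \<open>H'\<close> into
    \<open>- (p - 1) * (k - \<omega>)\<^sup>2\<close>, and the logarithm cancels the positive
    remainder \<open>p * b * \<omega> * (x - 1)\<close>. Both correction terms are bounded below, so
    a bound for \<open>K\<close> is one for \<open>H\<close>.\<close>
  define K where "K s = (k2 - k) * H s - \<omega> s + p * b / (p - 1) * ln (x s)" for s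
  have \<omega>: "0 < \<omega> s" "\<omega> s \<le> k" for s
    using \<theta>_pos[of s] \<theta>_le[of s] x_gt_1[of s] by (auto simp: \<omega>_def field_simps)
  have \<theta>: "\<theta> s = \<omega> s * (x s - 1)" for s
    using x_gt_1[of s] by (simp add: \<omega>_def)
  have dH: "(H has_real_derivative (p - 1) * (k - \<omega> s)) (at s)" for s
  proof -
    have "((\<lambda>s. ln (x s - 1) - ln (x s) + (p - 1) * k * s) has_real_derivative
        - ((p - 1) * x s * \<theta> s) / (x s - 1) + (p - 1) * x s * \<theta> s / x s + (p - 1) * k) (at s)"
      using x_gt_1[of s] by (auto intro!: derivative_eq_intros x_deriv)
    moreover have "ln (x s - 1) - ln (x s) + (p - 1) * k * s = H s" for s
      using x_gt_1[of s] by (simp add: H_def ln_div)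
    moreover have "- ((p - 1) * x s * \<theta> s) / (x s - 1) + (p - 1) * x s * \<theta> s / x s + (p - 1) * k =
        (p - 1) * (k - \<omega> s)"
      using x_gt_1[of s] unfolding \<theta> by (simp add: field_simps)
    ultimately show ?thesis by simp
  qed
  have d\<omega>: "(\<omega> has_real_derivative
      (p - 1) * (k - \<omega> s) * (k2 - \<omega> s) + (x s - 1) * \<omega> s * (p * \<omega> s - p * b)) (at s)" for s
  proof -
    have "(\<omega> has_real_derivative (((\<theta> s)\<^sup>2 - p * b * x s * \<theta> s + a\<^sup>2 * (x s - 1)) * (x s - 1)
        - \<theta> s * - ((p - 1) * x s * \<theta> s)) / ((x s - 1) * (x s - 1))) (at s)"
      unfolding \<omega>_def[abs_def]
      using x_gt_1[of s] by (auto intro!: derivative_eq_intros x_deriv \<theta>_deriv)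
    moreover have "((\<theta> s)\<^sup>2 - p * b * x s * \<theta> s + a\<^sup>2 * (x s - 1)) * (x s - 1)
        - \<theta> s * - ((p - 1) * x s * \<theta> s) =
        ((p - 1) * (\<omega> s)\<^sup>2 - p * b * \<omega> s + a\<^sup>2 + (x s - 1) * \<omega> s * (p * \<omega> s - p * b)) *
        ((x s - 1) * (x s - 1))"
      unfolding \<theta> by (simp add: algebra_simps power2_eq_square)
    moreover have "(p - 1) * (\<omega> s)\<^sup>2 - p * b * \<omega> s + a\<^sup>2 = (p - 1) * (k - \<omega> s) * (k2 - \<omega> s)"
      unfolding k_k2[symmetric] by (simp add: algebra_simps power2_eq_square)
    ultimately show ?thesis
      using x_gt_1[of s] by simp
  qed
  have dK: "(K has_real_derivative - ((p - 1) * (k - \<omega> s)\<^sup>2) - p * (\<omega> s)\<^sup>2 * (x s - 1)) (at s)" for s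
  proof -
    have "(K has_real_derivative (k2 - k) * ((p - 1) * (k - \<omega> s)) -
      ((p - 1) * (k - \<omega> s) * (k2 - \<omega> s) + (x s - 1) * \<omega> s * (p * \<omega> s - p * b)) +
      p * b / (p - 1) * (- ((p - 1) * x s * \<theta> s) / x s)) (at s)"
      unfolding K_def using x_pos[of s]
      by (auto intro!: derivative_eq_intros dH d\<omega> x_deriv)
    moreover have "p * b / (p - 1) * (- ((p - 1) * x s * \<theta> s) / x s) = - (p * b * \<omega> s * (x s - 1))"
      using p x_pos[of s] by (simp add: \<theta> field_simps)
    ultimately show ?thesis
      by (simp add: algebra_simps power2_eq_square)
  qed
  have mono: "H s \<le> H t" if "s \<le> t" for s t
  proof (rule DERIV_nonneg_imp_nondecreasing[OF that])
    fix r
    have "0 \<le> (p - 1) * (k - \<omega> r)" using \<omega>[of r] p by simp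
    with dH show "\<exists>y. (H has_real_derivative y) (at r) \<and> 0 \<le> y" by blast
  qed
  have "K t \<le> K 0" if "0 \<le> t" for t
  proof (rule DERIV_nonpos_imp_nonincreasing[OF that])
    fix r
    have "0 \<le> (p - 1) * (k - \<omega> r)\<^sup>2" "0 \<le> p * (\<omega> r)\<^sup>2 * (x r - 1)"
      using p x_gt_1[of r] by auto
    then have "- ((p - 1) * (k - \<omega> r)\<^sup>2) - p * (\<omega> r)\<^sup>2 * (x r - 1) \<le> 0"
      by linarith
    with dK show "\<exists>y. (K has_real_derivative y) (at r) \<and> y \<le> 0" by blast
  qed
  moreover have "0 \<le> p * b / (p - 1) * ln (x t)" for t
    using p b x_gt_1[of t] by simp
  ultimately have "(k2 - k) * H t \<le> K 0 + k" if "0 \<le> t" for t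
    using \<omega>(2)[of t] that unfolding K_def by (smt (verit))
  then have "H t \<le> (K 0 + k) / (k2 - k)" if "0 \<le> t" for t
    using k_less_k2 that by (simp add: field_simps)
  then have "H t \<le> (K 0 + k) / (k2 - k)" for t
    using mono[of t 0] by (cases "0 \<le> t") (auto intro: order_trans)
  then obtain L where "(H \<longlongrightarrow> L) at_top"
    using mono_bounded_tendsto_at_top[of H, OF mono] by blast
  then show thesis
    using that by (simp add: H_def[abs_def])
qed

text \<open>The normalised \<open>v powr p\<close> is \<open>x powr (p / (p - 1))\<close>, whose
  deviation from 1 is to first order \<open>p / (p - 1)\<close> times that of \<open>x\<close>. The
  coefficient is positive as a multiple of the exponential of a finite limit.\<close>

lemma asymptotics_at_top:
  obtains B where "0 < B"
    "((\<lambda>s. (v s powr p / (b / \<beta>) powr (p / (p - 1)) - 1) * exp ((p - 1) * k * s)) \<longlongrightarrow> B) at_top"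
proof -
  define \<gamma> where "\<gamma> = (p - 1) * k"
  have \<gamma>: "0 < \<gamma>" using p k by (simp add: \<gamma>_def)
  define q where "q = p / (p - 1)"
  have q: "0 < q" using p by (simp add: q_def)
  obtain L where L: "((\<lambda>s. ln ((x s - 1) / x s) + \<gamma> * s) \<longlongrightarrow> L) at_top"
    unfolding \<gamma>_def by (rule log_deviation_converges)
  have "(x s - 1) / x s * exp (\<gamma> * s) = exp (ln ((x s - 1) / x s) + \<gamma> * s)" for s
    using x_gt_1[of s] by (simp add: exp_add)
  then have lim1: "((\<lambda>s. (x s - 1) / x s * exp (\<gamma> * s)) \<longlongrightarrow> exp L) at_top"
    using tendsto_exp[OF L] by simp
  have "filterlim (\<lambda>s. \<gamma> * s) at_top at_top"
    by (rule filterlim_tendsto_pos_mult_at_top[OF tendsto_const \<gamma> filterlim_ident])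
  then have "((\<lambda>s. exp (- (\<gamma> * s))) \<longlongrightarrow> 0) at_top"
    by (intro filterlim_compose[OF exp_at_bot]) (simp add: filterlim_uminus_at_top)
  from tendsto_mult[OF lim1 this] have "((\<lambda>s. (x s - 1) / x s) \<longlongrightarrow> 0) at_top"
    by (simp add: mult.assoc flip: exp_add)
  then have "((\<lambda>s. 1 / (1 - (x s - 1) / x s)) \<longlongrightarrow> 1 / (1 - 0)) at_top"
    by (intro tendsto_intros) auto
  moreover have "1 / (1 - (x s - 1) / x s) = x s" for s
    using x_pos[of s] by (simp add: field_simps)
  ultimately have x_lim: "(x \<longlongrightarrow> 1) at_top"
    by simp
  from tendsto_mult[OF this lim1] have lim2: "((\<lambda>s. (x s - 1) * exp (\<gamma> * s)) \<longlongrightarrow> exp L) at_top"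
    using x_pos by (simp add: less_imp_neq[symmetric])
  have "((\<lambda>y. y powr q) has_real_derivative q * 1 powr (q - 1)) (at 1)"
    by (rule has_real_derivative_powr) simp
  then have "((\<lambda>y. (y powr q - 1) / (y - 1)) \<longlongrightarrow> q) (at 1)"
    by (simp add: has_field_derivative_iff)
  moreover have "filterlim x (at 1) at_top"
    unfolding filterlim_at using x_lim x_gt_1 by (auto intro!: always_eventually simp: less_imp_neq[symmetric])
  ultimately have "((\<lambda>s. (x s powr q - 1) / (x s - 1)) \<longlongrightarrow> q) at_top"
    by (rule filterlim_compose)
  from tendsto_mult[OF this lim2]
  have "((\<lambda>s. (x s powr q - 1) / (x s - 1) * ((x s - 1) * exp (\<gamma> * s))) \<longlongrightarrow> q * exp L) at_top" .
  moreover have eq: "(x s powr q - 1) / (x s - 1) * ((x s - 1) * exp (\<gamma> * s)) =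
      (v s powr p / (b / \<beta>) powr q - 1) * exp (\<gamma> * s)" for s
  proof -
    have "x s = v s powr (p - 1) / (b / \<beta>)"
      by (simp add: x_def)
    then have "x s powr q = v s powr p / (b / \<beta>) powr q"
      using \<beta> b p q by (simp add: powr_divide powr_mult powr_powr q_def)
    then show ?thesis
      using x_gt_1[of s] by simp
  qed
  ultimately have "((\<lambda>s. (v s powr p / (b / \<beta>) powr q - 1) * exp (\<gamma> * s)) \<longlongrightarrow> q * exp L) at_top"
    unfolding eq by simp
  moreover have "0 < q * exp L" using q by simp
  ultimately show thesis
    using that unfolding q_def \<gamma>_def by blast
qed

end

section \<open>Uniqueness of the singular solution\<close>

context cooperative
begin

text \<open>The energy \<open>I\<^sup>2 + \<kappa> J\<^sup>2\<close> of the rescaled differences decays at \<open>-\<infinity>\<close>, and the strong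
  damping of \<open>J\<close> there makes its logarithmic derivative integrable near \<open>-\<infinity>\<close>.\<close>

lemma singular_solution_unique:
  assumes sol: "solution v1 e1" "solution v2 e2"
    and lim: "((\<lambda>s. v1 s powr p * exp (c * s)) \<longlongrightarrow> K) at_bot"
      "((\<lambda>s. v2 s powr p * exp (c * s)) \<longlongrightarrow> K) at_bot"
    and K: "0 < K"
  shows "v1 s = v2 s"
proof -
  define \<epsilon> where "\<epsilon> = c - c / p"
  have \<epsilon>: "0 < \<epsilon>" using p_gt by (simp add: \<epsilon>_def)
  have pos: "0 < v1 s" "0 < v2 s" for s
    using sol by (auto simp: solution_def)
  have power_lim: "((\<lambda>s. v s powr q * exp (c * q / p * s)) \<longlongrightarrow> K powr (q / p)) at_bot"
    if "((\<lambda>s. v s powr p * exp (c * s)) \<longlongrightarrow> K) at_bot" "\<And>s. 0 < v s" for v :: "real \<Rightarrow> real" and q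
  proof -
    have "((\<lambda>s. (v s powr p * exp (c * s)) powr (q / p)) \<longlongrightarrow> K powr (q / p)) at_bot"
      using K by (intro tendsto_intros that) auto
    moreover have "(v s powr p * exp (c * s)) powr (q / p) = v s powr q * exp (c * q / p * s)" for s
      using that(2)[of s] by (simp add: powr_mult powr_powr exp_powr_real mult_ac less_imp_le)
    ultimately show ?thesis by simp
  qed
  \<comment> \<open>The weight \<open>exp (c * s)\<close> cancels the damping of \<open>e\<close>,
    leaving \<open>I' = \<kappa> * J\<close>, and it is the weight under which the powers have a
    common limit, so that \<open>R\<close> tends to 0.\<close>
  define I where "I s = exp (c * s) * (e1 s - e2 s)" for s
  define J where "J s = exp (c * s) * (v1 s - v2 s)" for s
  define R where "R s = exp (c * s) * (v1 s powr p - v2 s powr p)" for s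
  define J' where "J' s = I s + 2 * c * J s - \<beta> * R s" for s
  have dI: "(I has_real_derivative \<kappa> * J s) (at s)" for s
  proof -
    have "(e1 has_real_derivative \<kappa> * v1 s - c * e1 s) (at s)"
        "(e2 has_real_derivative \<kappa> * v2 s - c * e2 s) (at s)"
      using sol by (auto simp: solution_def)
    then show ?thesis
      unfolding I_def J_def by (auto intro!: derivative_eq_intros simp: algebra_simps)
  qed
  have dJ: "(J has_real_derivative J' s) (at s)" for s
  proof -
    have "(v1 has_real_derivative e1 s + c * v1 s - \<beta> * v1 s powr p) (at s)"
        "(v2 has_real_derivative e2 s + c * v2 s - \<beta> * v2 s powr p) (at s)"
      using sol by (auto simp: solution_def)
    then show ?thesis
      unfolding J'_def I_def J_def R_def by (auto intro!: derivative_eq_intros simp: algebra_simps)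
  qed
  have R_lim: "(R \<longlongrightarrow> 0) at_bot"
    using tendsto_diff[OF lim] by (simp add: R_def[abs_def] algebra_simps)
  \<comment> \<open>The factor \<open>exp (c / p * s)\<close> already makes both solutions converge;
    the remaining \<open>exp (\<epsilon> * s)\<close> tends to 0.\<close>
  have "((\<lambda>s. exp (\<epsilon> * s) * (v1 s powr 1 * exp (c * 1 / p * s) - v2 s powr 1 * exp (c * 1 / p * s)))
      \<longlongrightarrow> 0 * (K powr (1 / p) - K powr (1 / p))) at_bot"
    using \<epsilon> by (intro tendsto_intros tendsto_exp_at_bot power_lim lim pos)
  moreover have "exp (\<epsilon> * s) * (v1 s powr 1 * exp (c * 1 / p * s) - v2 s powr 1 * exp (c * 1 / p * s)) = J s"
    for s
  proof -
    have "exp (c * s) = exp (\<epsilon> * s) * exp (c * 1 / p * s)"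
      by (simp add: \<epsilon>_def algebra_simps flip: exp_add)
    then show ?thesis
      using pos[of s] by (simp add: J_def algebra_simps)
  qed
  ultimately have J_lim: "(J \<longlongrightarrow> 0) at_bot"
    by simp
  \<comment> \<open>Nothing is assumed about \<open>e1\<close> and \<open>e2\<close> at
    \<open>-\<infinity>\<close>. The mean value theorem on an interval of length 1 gives a point
    where \<open>J'\<close> is small, hence so is \<open>I\<close>, and
    \<open>I' = \<kappa> * J\<close> carries this to \<open>s\<close>.\<close>
  have I_lim: "(I \<longlongrightarrow> 0) at_bot"
  proof (rule tendstoI)
    fix r :: real assume r: "0 < r"
    define Q where "Q = 2 + 2 * c + \<beta> + \<kappa>"
    define \<eta> where "\<eta> = r / (2 * Q)"
    have Q: "0 < Q" using c \<beta> \<kappa> by (simp add: Q_def)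
    have \<eta>: "0 < \<eta>" "Q * \<eta> < r" using r Q by (auto simp: \<eta>_def field_simps)
    have "\<forall>\<^sub>F s in at_bot. \<bar>J s\<bar> < \<eta> \<and> \<bar>R s\<bar> < \<eta>"
      using tendstoD[OF J_lim \<eta>(1)] tendstoD[OF R_lim \<eta>(1)] by eventually_elim auto
    then obtain s0 where s0: "\<And>s. s \<le> s0 \<Longrightarrow> \<bar>J s\<bar> < \<eta> \<and> \<bar>R s\<bar> < \<eta>"
      by (auto simp: eventually_at_bot_linorder)
    have "dist (I s) 0 < r" if s: "s \<le> s0" for s
    proof -
      have "\<exists>z>s - 1. z < s \<and> J s - J (s - 1) = (s - (s - 1)) * J' z"
        by (rule MVT2) (auto intro: dJ)
      then obtain z where z: "s - 1 < z" "z < s" "J' z = J s - J (s - 1)" by auto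
      have "\<exists>y>z. y < s \<and> I s - I z = (s - z) * (\<kappa> * J y)"
        by (rule MVT2[OF z(2)]) (auto intro: dI)
      then obtain y where y: "z < y" "y < s" "I s - I z = (s - z) * (\<kappa> * J y)" by auto
      have bounds: "\<bar>J s\<bar> < \<eta>" "\<bar>J (s - 1)\<bar> < \<eta>" "\<bar>J z\<bar> < \<eta>" "\<bar>R z\<bar> < \<eta>" "\<bar>J y\<bar> < \<eta>"
        using s0 s z y by auto
      have "\<bar>I s - I z\<bar> \<le> 1 * (\<kappa> * \<eta>)"
        unfolding y(3) abs_mult using z bounds \<kappa> by (intro mult_mono) auto
      moreover have "I z = J s - J (s - 1) - 2 * c * J z + \<beta> * R z"
        using z(3) by (simp add: J'_def)
      then have "\<bar>I z\<bar> \<le> \<bar>J s\<bar> + \<bar>J (s - 1)\<bar> + 2 * c * \<bar>J z\<bar> + \<beta> * \<bar>R z\<bar>"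
        using c \<beta> abs_mult[of "2 * c" "J z"] abs_mult[of \<beta> "R z"] by simp
      moreover have "2 * c * \<bar>J z\<bar> \<le> 2 * c * \<eta>" "\<beta> * \<bar>R z\<bar> \<le> \<beta> * \<eta>"
        using bounds c \<beta> by auto
      moreover have "Q * \<eta> = 2 * \<eta> + 2 * c * \<eta> + \<beta> * \<eta> + \<kappa> * \<eta>"
        by (simp add: Q_def algebra_simps)
      ultimately have "\<bar>I s\<bar> \<le> Q * \<eta>"
        using bounds by linarith
      then show ?thesis using \<eta> by simp
    qed
    then show "\<forall>\<^sub>F s in at_bot. dist (I s) 0 < r"
      unfolding eventually_at_bot_linorder by blast
  qed
  define E where "E s = (I s)\<^sup>2 + \<kappa> * (J s)\<^sup>2" for s
  define E' where "E' s = \<kappa> * (4 * I s * J s + 4 * c * (J s)\<^sup>2 - 2 * \<beta> * (J s * R s))" for s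
  have dE: "(E has_real_derivative E' s) (at s)" for s
    unfolding E_def E'_def
    by (auto intro!: derivative_eq_intros dI dJ simp: J'_def algebra_simps power2_eq_square)
  have E_nonneg: "0 \<le> E s" and EI: "(I s)\<^sup>2 \<le> E s" and EJ: "\<kappa> * (J s)\<^sup>2 \<le> E s" for s
    using \<kappa> by (auto simp: E_def)
  have "((\<lambda>s. (I s)\<^sup>2 + \<kappa> * (J s)\<^sup>2) \<longlongrightarrow> 0\<^sup>2 + \<kappa> * 0\<^sup>2) at_bot"
    by (intro tendsto_intros I_lim J_lim)
  then have E_lim: "(E \<longlongrightarrow> 0) at_bot"
    by (simp add: E_def[abs_def])
  \<comment> \<open>A lower bound for the difference quotient of \<open>t powr p\<close> between the
    two solutions; it measures the damping in the energy.\<close>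
  define d where "d s = min (v1 s powr (p - 1)) (v2 s powr (p - 1))" for s
  have d: "0 \<le> d s" for s
    by (simp add: d_def)
  have JR: "d s * (J s)\<^sup>2 \<le> J s * R s" for s
  proof -
    have *: "y powr (p - 1) * (x - y)\<^sup>2 \<le> (x - y) * (x powr p - y powr p)"
      if "0 < y" "y \<le> x" for x y :: real
    proof -
      have "y powr (p - 1) * x \<le> x powr (p - 1) * x"
        using that p by (intro mult_right_mono powr_mono2) auto
      then have "y powr (p - 1) * (x - y) \<le> x powr p - y powr p"
        using that powr_mult_base[of x "p - 1"] powr_mult_base[of y "p - 1"] by (simp add: algebra_simps)
      then have "(x - y) * (y powr (p - 1) * (x - y)) \<le> (x - y) * (x powr p - y powr p)"
        using that by (intro mult_left_mono) auto
      then show ?thesis by (simp add: power2_eq_square mult_ac)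
    qed
    have "d s * (v1 s - v2 s)\<^sup>2 \<le> (v1 s - v2 s) * (v1 s powr p - v2 s powr p)"
    proof (cases "v2 s \<le> v1 s")
      case True
      have "d s * (v1 s - v2 s)\<^sup>2 \<le> v2 s powr (p - 1) * (v1 s - v2 s)\<^sup>2"
        by (intro mult_right_mono) (auto simp: d_def)
      with *[OF pos(2) True] show ?thesis by linarith
    next
      case False
      have "d s * (v1 s - v2 s)\<^sup>2 \<le> v1 s powr (p - 1) * (v2 s - v1 s)\<^sup>2"
        unfolding power2_commute[of "v1 s"] by (intro mult_right_mono) (auto simp: d_def)
      with *[OF pos(1), of s "v2 s"] False show ?thesis by (simp add: algebra_simps)
    qed
    then have "exp (c * s) * exp (c * s) * (d s * (v1 s - v2 s)\<^sup>2) \<le>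
        exp (c * s) * exp (c * s) * ((v1 s - v2 s) * (v1 s powr p - v2 s powr p))"
      by (intro mult_left_mono) auto
    then show ?thesis
      by (simp add: J_def R_def power2_eq_square mult_ac)
  qed
  have E'_le: "E' s \<le> \<kappa> * (4 * I s * J s + 4 * c * (J s)\<^sup>2 - 2 * \<beta> * (d s * (J s)\<^sup>2))" for s
    unfolding E'_def using \<kappa> \<beta> JR[of s] by (intro mult_left_mono diff_left_mono) auto
  \<comment> \<open>Half the limit of \<open>\<beta> * v powr (p - 1) * exp (\<epsilon> * s)\<close>
    for both solutions, hence a strict lower bound near \<open>-\<infinity>\<close>.\<close>
  define \<nu> where "\<nu> = \<beta> * K powr ((p - 1) / p) / 2"
  have \<nu>: "0 < \<nu>" using \<beta> K by (simp add: \<nu>_def)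
  have "\<forall>\<^sub>F s in at_bot. \<nu> / \<beta> < v1 s powr (p - 1) * exp (c * (p - 1) / p * s)"
       "\<forall>\<^sub>F s in at_bot. \<nu> / \<beta> < v2 s powr (p - 1) * exp (c * (p - 1) / p * s)"
    using K \<beta> by (intro order_tendstoD(1)[OF power_lim] lim pos; simp add: \<nu>_def)+
  moreover have "\<forall>\<^sub>F s in at_bot. 4 * c / \<nu> \<le> exp (- \<epsilon> * s)"
    using filterlim_exp_minus_at_bot[OF \<epsilon>] by (simp add: filterlim_at_top)
  \<comment> \<open>Half of the damping pays for the growth term \<open>4 * c\<close>; the other
    half is kept for the mixed term \<open>4 * I * J\<close>.\<close>
  ultimately have "\<forall>\<^sub>F s in at_bot. \<nu> * exp (- \<epsilon> * s) + 4 * c \<le> 2 * \<beta> * d s"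
  proof eventually_elim
    case (elim s)
    have *: "\<nu> * exp (- \<epsilon> * s) \<le> \<beta> * y" if "\<nu> / \<beta> < y * exp (c * (p - 1) / p * s)" for y
    proof -
      have "c * (p - 1) / p = \<epsilon>"
        using p by (simp add: \<epsilon>_def field_simps)
      then have "\<nu> \<le> \<beta> * y * exp (\<epsilon> * s)"
        using that \<beta> by (simp add: field_simps)
      then have "\<nu> * exp (- \<epsilon> * s) \<le> \<beta> * y * exp (\<epsilon> * s) * exp (- \<epsilon> * s)"
        by (intro mult_right_mono) auto
      then show ?thesis
        by (simp add: mult.assoc flip: exp_add)
    qed
    have "\<nu> * exp (- \<epsilon> * s) \<le> \<beta> * d s"
      using *[OF elim(1)] *[OF elim(2)] by (auto simp: d_def min_def)
    moreover have "4 * c \<le> \<nu> * exp (- \<epsilon> * s)"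
      using elim(3) \<nu> by (simp add: field_simps)
    ultimately show ?case by linarith
  qed
  then obtain s0 where s0: "\<And>s. s \<le> s0 \<Longrightarrow> \<nu> * exp (- \<epsilon> * s) + 4 * c \<le> 2 * \<beta> * d s"
    by (auto simp: eventually_at_bot_linorder)
  define g where "g s = 4 * \<kappa> / \<nu> * exp (\<epsilon> * s)" for s
  define G where "G s = 4 * \<kappa> / (\<nu> * \<epsilon>) * exp (\<epsilon> * s)" for s
  have dG: "(G has_real_derivative g s) (at s)" for s
    unfolding G_def g_def using \<epsilon> \<nu> by (auto intro!: derivative_eq_intros)
  have E'_gE: "E' s \<le> g s * E s" if "s \<le> s0" for s
  proof -
    define t where "t = exp (\<epsilon> * s)"
    have t: "0 < t" "exp (- \<epsilon> * s) = 1 / t"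
      by (simp_all add: t_def exp_minus field_simps)
    have "(\<nu> / t + 4 * c) * (J s)\<^sup>2 \<le> 2 * \<beta> * d s * (J s)\<^sup>2"
      using s0[OF that] t by (intro mult_right_mono) auto
    \<comment> \<open>Completing the square replaces the mixed term by \<open>I\<^sup>2\<close> with
      a factor of order \<open>exp (\<epsilon> * s)\<close>, which is integrable at
      \<open>-\<infinity>\<close>.\<close>
    moreover have "4 * I s * J s - \<nu> / t * (J s)\<^sup>2 \<le> 4 / \<nu> * t * (I s)\<^sup>2"
    proof -
      have "0 \<le> \<nu> / t * (J s - 2 * t / \<nu> * I s)\<^sup>2"
        using \<nu> t by simp
      also have "\<dots> = \<nu> / t * (J s)\<^sup>2 - 4 * I s * J s + 4 / \<nu> * t * (I s)\<^sup>2"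
        using \<nu> t by (simp add: field_simps power2_eq_square)
      finally show ?thesis by simp
    qed
    ultimately have "4 * I s * J s + 4 * c * (J s)\<^sup>2 - 2 * \<beta> * (d s * (J s)\<^sup>2) \<le> 4 / \<nu> * t * (I s)\<^sup>2"
      by (simp add: algebra_simps)
    also have "\<dots> \<le> 4 / \<nu> * t * E s"
      using \<nu> t EI by (intro mult_left_mono) auto
    finally have "\<kappa> * (4 * I s * J s + 4 * c * (J s)\<^sup>2 - 2 * \<beta> * (d s * (J s)\<^sup>2)) \<le>
        \<kappa> * (4 / \<nu> * t * E s)"
      using \<kappa> by (intro mult_left_mono) auto
    with E'_le[of s] show ?thesis
      by (simp add: g_def t_def mult_ac)
  qed
  have below: "E s = 0" if "s \<le> s0" for s
  proof -
    \<comment> \<open>The nonnegative antiderivative \<open>G\<close> keeps the bound uniform in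
      \<open>t\<close>, so \<open>t\<close> may go to \<open>-\<infinity>\<close>, where
      \<open>E\<close> vanishes.\<close>
    have "E s * exp (- G s) \<le> E t" if "t \<le> s" for t
    proof -
      have "- E t * exp (- G t) \<le> - E s * exp (- G s)"
        using gronwall_mono[OF dG DERIV_minus[OF dE] _ that] E'_gE \<open>s \<le> s0\<close> by simp
      moreover have "E t * exp (- G t) \<le> E t * 1"
        using E_nonneg \<kappa> \<nu> \<epsilon> by (intro mult_left_mono) (auto simp: G_def)
      ultimately show ?thesis by linarith
    qed
    then have "E s * exp (- G s) \<le> 0"
      by (intro tendsto_lowerbound[OF E_lim]) (auto simp: eventually_at_bot_linorder)
    then show ?thesis
      using E_nonneg[of s] by (simp add: mult_le_0_iff)
  qed
  have E0: "E s0 = 0" using below by simp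
  \<comment> \<open>To the right of \<open>s0\<close> the damping term is dropped for its sign, and
    a constant rate \<open>L\<close> propagates the zero of \<open>E\<close> forwards.\<close>
  have above: "E s = 0" if "s0 \<le> s" for s
  proof -
    define L where "L = 2 * \<kappa> + 2 + 4 * c"
    have "E' s \<le> L * E s" for s
    proof -
      have "E' s \<le> \<kappa> * (4 * I s * J s + 4 * c * (J s)\<^sup>2)"
      proof (rule order_trans[OF E'_le])
        have "0 \<le> 2 * \<beta> * (d s * (J s)\<^sup>2)"
          using \<beta> d by simp
        then show "\<kappa> * (4 * I s * J s + 4 * c * (J s)\<^sup>2 - 2 * \<beta> * (d s * (J s)\<^sup>2)) \<le>
            \<kappa> * (4 * I s * J s + 4 * c * (J s)\<^sup>2)"
          using \<kappa> by (intro mult_left_mono) auto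
      qed
      moreover have "2 * I s * J s \<le> (I s)\<^sup>2 + (J s)\<^sup>2"
        using sum_squares_bound[of "I s" "J s"] .
      then have "\<kappa> * (4 * I s * J s) \<le> \<kappa> * (2 * (I s)\<^sup>2 + 2 * (J s)\<^sup>2)"
        using \<kappa> by (intro mult_left_mono) auto
      ultimately have "E' s \<le> 2 * \<kappa> * (I s)\<^sup>2 + (2 + 4 * c) * (\<kappa> * (J s)\<^sup>2)"
        by (simp add: algebra_simps)
      also have "\<dots> \<le> 2 * \<kappa> * E s + (2 + 4 * c) * E s"
        using EI EJ \<kappa> c by (intro add_mono mult_left_mono) auto
      finally show ?thesis by (simp add: L_def algebra_simps)
    qed
    moreover have "((\<lambda>s. L * s) has_real_derivative L) (at s)" for s
      by (auto intro!: derivative_eq_intros)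
    ultimately have "- E s0 * exp (- (L * s0)) \<le> - E s * exp (- (L * s))"
      using gronwall_mono[of "\<lambda>s. L * s" "\<lambda>_. L", OF _ DERIV_minus[OF dE] _ that] by simp
    then show ?thesis
      using E_nonneg[of s] E0 by (simp add: mult_le_0_iff)
  qed
  have "E s = 0" using below above by (cases "s \<le> s0") auto
  then have "\<kappa> * (J s)\<^sup>2 \<le> 0" using EJ[of s] by simp
  then have "J s = 0" using \<kappa> by (simp add: mult_le_0_iff)
  then show ?thesis by (simp add: J_def)
qed

end

section \<open>Profiles and solutions of the system\<close>

context cooperative
begin

text \<open>The four families go through one induction because the system expresses the derivative
  of each by products and sums of all of them. All exponents \<open>q\<close> occur at once, as
  differentiation shifts them.\<close>

lemma Ck_on_radial_solution:
  fixes v e :: "real \<Rightarrow> real"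
  assumes "solution v e"
  shows "\<forall>b\<in>Basis. Ck_on j (\<lambda>y::'a::euclidean_space. y \<bullet> b) (- {0})"
    and "\<forall>q. Ck_on j (\<lambda>y::'a. norm y powr q) (- {0})"
    and "\<forall>q. Ck_on j (\<lambda>y::'a. v (ln (norm y)) powr q) (- {0})"
    and "Ck_on j (\<lambda>y::'a. e (ln (norm y))) (- {0})"
proof (induction j)
  case 0
  have v: "0 < v s" "isCont v s" "isCont e s" for s
    using assms DERIV_isCont by (auto simp: solution_def)
  have "continuous_on (- {0}) (\<lambda>y::'a. v (ln (norm y)))" "continuous_on (- {0}) (\<lambda>y::'a. e (ln (norm y)))"
    by (auto intro!: continuous_at_imp_continuous_on isCont_o2[of _ _ v] isCont_o2[of _ _ e] v
        continuous_intros simp del: continuous_at_imp_continuous_on)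
  then show "\<forall>b\<in>Basis. Ck_on 0 (\<lambda>y::'a. y \<bullet> b) (- {0})"
    and "\<forall>q. Ck_on 0 (\<lambda>y::'a. norm y powr q) (- {0})"
    and "\<forall>q. Ck_on 0 (\<lambda>y::'a. v (ln (norm y)) powr q) (- {0})"
    and "Ck_on 0 (\<lambda>y::'a. e (ln (norm y))) (- {0})"
    using v(1) by (auto intro!: continuous_intros) (metis less_irrefl)
next
  case (Suc j)
  have op: "open (- {0::'a})" by auto
  note ops = Ck_on_add[OF op] Ck_on_mult[OF op] Ck_on_const
  have v: "0 < v s" "(v has_real_derivative e s + c * v s - \<beta> * v s powr p) (at s)"
      "(e has_real_derivative \<kappa> * v s - c * e s) (at s)" for s
    using assms by (auto simp: solution_def)
  have radial: "Ck_on (Suc j) (\<lambda>y::'a. F (norm y)) (- {0})"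
    if "\<And>r. 0 < r \<Longrightarrow> (F has_real_derivative F' r) (at r)"
      "Ck_on j (\<lambda>y::'a. F' (norm y) / norm y) (- {0})" for F F' :: "real \<Rightarrow> real"
  proof (rule Ck_on_SucI[OF op])
    fix y :: 'a assume "y \<in> - {0}"
    then show "((\<lambda>y. F (norm y)) has_derivative (\<lambda>h. F' (norm y) / norm y * (y \<bullet> h))) (at y)"
      by (intro has_derivative_radial[where G=F] that(1)) auto
  next
    fix b :: 'a assume "b \<in> Basis"
    with Suc show "Ck_on j (\<lambda>y::'a. F' (norm y) / norm y * (y \<bullet> b)) (- {0})"
      by (intro ops that) auto
  qed
  have V1: "Ck_on j (\<lambda>y::'a. v (ln (norm y))) (- {0})"
    by (rule Ck_on_cong[OF op _ Suc(3)[rule_format, of 1]]) (use v(1) in \<open>simp add: less_imp_le\<close>)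
  show "\<forall>b\<in>Basis. Ck_on (Suc j) (\<lambda>y::'a. y \<bullet> b) (- {0})"
  proof
    fix b :: 'a
    show "Ck_on (Suc j) (\<lambda>y::'a. y \<bullet> b) (- {0})"
      by (rule Ck_on_SucI[OF op, of _ "\<lambda>_ h. h \<bullet> b"])
        (auto intro!: derivative_eq_intros Ck_on_const)
  qed
  show "\<forall>q. Ck_on (Suc j) (\<lambda>y::'a. norm y powr q) (- {0})"
  proof
    fix q
    show "Ck_on (Suc j) (\<lambda>y::'a. norm y powr q) (- {0})"
    proof (rule radial)
      show "((\<lambda>r. r powr q) has_real_derivative q * r powr (q - 1)) (at r)" if "0 < r" for r
        using that by (rule has_real_derivative_powr)
      have "Ck_on j (\<lambda>y::'a. q * norm y powr (q - 2)) (- {0})"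
        using Suc by (auto intro!: ops)
      then show "Ck_on j (\<lambda>y::'a. q * norm y powr (q - 1) / norm y) (- {0})"
        by (rule Ck_on_cong[OF op, rotated]) (simp add: powr_diff power2_eq_square)
    qed
  qed
  show "\<forall>q. Ck_on (Suc j) (\<lambda>y::'a. v (ln (norm y)) powr q) (- {0})"
  proof
    fix q
    show "Ck_on (Suc j) (\<lambda>y::'a. v (ln (norm y)) powr q) (- {0})"
    proof (rule radial)
      show "((\<lambda>r. v (ln r) powr q) has_real_derivative q * v (ln r) powr (q - 1) *
          ((e (ln r) + c * v (ln r) - \<beta> * v (ln r) powr p) / r)) (at r)" if "0 < r" for r
        using DERIV_chain2[OF has_real_derivative_powr[OF v(1)] DERIV_chain2[OF v(2) DERIV_ln_divide[OF that]]]
        by simp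
      have "Ck_on j (\<lambda>y::'a. q * v (ln (norm y)) powr (q - 1) * ((e (ln (norm y)) +
          (c * v (ln (norm y)) + - \<beta> * v (ln (norm y)) powr p)) * norm y powr - 2)) (- {0})"
        by (intro ops Suc[rule_format] V1)
      then show "Ck_on j (\<lambda>y::'a. q * v (ln (norm y)) powr (q - 1) * ((e (ln (norm y)) +
          c * v (ln (norm y)) - \<beta> * v (ln (norm y)) powr p) / norm y) / norm y) (- {0})"
        by (rule Ck_on_cong[OF op, rotated]) (simp add: powr_minus divide_simps power2_eq_square)
    qed
  qed
  show "Ck_on (Suc j) (\<lambda>y::'a. e (ln (norm y))) (- {0})"
  proof (rule radial)
    show "((\<lambda>r. e (ln r)) has_real_derivative (\<kappa> * v (ln r) - c * e (ln r)) / r) (at r)"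
      if "0 < r" for r
      using DERIV_chain2[OF v(3) DERIV_ln_divide[OF that]] by simp
    have "Ck_on j (\<lambda>y::'a. (\<kappa> * v (ln (norm y)) + - c * e (ln (norm y))) * norm y powr - 2) (- {0})"
      by (intro ops Suc[rule_format] V1)
    then show "Ck_on j (\<lambda>y::'a. (\<kappa> * v (ln (norm y)) - c * e (ln (norm y))) / norm y / norm y) (- {0})"
      by (rule Ck_on_cong[OF op, rotated]) (simp add: powr_minus divide_simps power2_eq_square)
  qed
qed

end

lemma DERIV_powr_mult_ln:
  fixes f :: "real \<Rightarrow> real"
  assumes "(f has_real_derivative f') (at (ln r))" "0 < r"
  shows "((\<lambda>r. r powr q * f (ln r)) has_real_derivative r powr (q - 1) * (q * f (ln r) + f')) (at r)"
proof -
  have "((\<lambda>r. r powr q * f (ln r)) has_real_derivative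
      q * r powr (q - 1) * f (ln r) + f' * (1 / r) * r powr q) (at r)"
    using DERIV_mult[OF has_real_derivative_powr[OF assms(2), of q]
        DERIV_chain2[OF assms(1) DERIV_ln_divide[OF assms(2)]]] .
  moreover have "q * r powr (q - 1) * f (ln r) + f' * (1 / r) * r powr q =
      r powr (q - 1) * (q * f (ln r) + f')"
    using assms(2) by (simp add: powr_diff field_simps)
  ultimately show ?thesis
    by simp
qed

lemma DERIV_along_ray:
  fixes f :: "'a::euclidean_space \<Rightarrow> real"
  assumes "f differentiable (at (r *\<^sub>R b))"
  shows "((\<lambda>r. f (r *\<^sub>R b)) has_real_derivative partial b f (r *\<^sub>R b)) (at r)"
proof -
  define D where "D = frechet_derivative f (at (r *\<^sub>R b))"
  have D: "(f has_derivative D) (at (r *\<^sub>R b))"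
    using assms by (simp add: D_def frechet_derivative_works)
  have "((\<lambda>r. r *\<^sub>R b) has_derivative (\<lambda>t. t *\<^sub>R b)) (at r)"
    by (auto intro!: derivative_eq_intros)
  from has_derivative_compose[OF this D] have "((\<lambda>r. f (r *\<^sub>R b)) has_derivative (\<lambda>t. D (t *\<^sub>R b))) (at r)"
    by simp
  moreover have "D (t *\<^sub>R b) = D b * t" for t
    using linear_cmul[OF has_derivative_linear[OF D]] by simp
  ultimately show ?thesis
    by (simp add: has_field_derivative_def partial_def D_def[symmetric])
qed

lemma filterlim_ln_norm_at_0: "filterlim (\<lambda>y::'a::real_normed_vector. ln (norm y)) at_bot (at 0)"
proof (rule filterlim_compose[OF ln_at_0])
  have "(norm \<longlongrightarrow> 0) (at (0::'a))"
    by (rule tendsto_norm_zero) (rule tendsto_ident_at)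
  then show "filterlim (norm :: 'a \<Rightarrow> real) (at_right 0) (at 0)"
    by (auto simp: filterlim_at eventually_at_filter)
qed

section \<open>Parameters of the fast diffusion equation\<close>

locale fast_diffusion =
  fixes N m n C \<alpha> \<beta> \<gamma> a c \<kappa> :: real
  assumes N: "3 \<le> N"
    and m_eq: "m = (N - 2) / (N + 2)"
    and n_eq: "n = 1 - m"
    and C_eq: "C = 2 * m * ((1 - m) * N - 2) / n"
    and \<beta>_gt: "1 / (2 * m) < \<beta>"
    and \<alpha>_eq: "\<alpha> = (1 + 2 * \<beta>) / n"
    and \<gamma>_eq: "\<gamma> = (\<beta> * (N - 2) - sqrt (\<beta>\<^sup>2 * (N - 2)\<^sup>2 - 4 * (N - 2))) / 2"
    and a_def: "a = (N - 2) / 2"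
    and c_def: "c = 1 / (n * \<beta>)"
    and \<kappa>_def: "\<kappa> = a\<^sup>2 - c\<^sup>2"
begin

lemma n: "n = 4 / (N + 2)"
  using N by (simp add: n_eq m_eq field_simps)

lemma n_pos: "0 < n" and m_pos: "0 < m"
  using N by (auto simp: n m_eq)

lemma a_pos: "0 < a"
  using N by (simp add: a_def)

lemma N_eq: "N = 2 * a + 2"
  by (simp add: a_def field_simps)

lemma m_a: "m = a / (a + 2)" and n_a: "n = 2 / (a + 2)" and two_n: "2 / n = a + 2"
  using a_pos by (auto simp: m_eq n N_eq field_simps)

lemma m_n: "m = a * n / 2"
  using a_pos by (simp add: m_a n_a field_simps)

lemma C: "C = a\<^sup>2 * n"
proof -
  have "(1 - m) * N - 2 = 2 * m"
    using a_pos by (simp add: m_a N_eq field_simps)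
  then have "C = 2 * m * (2 * m) / n"
    by (simp only: C_eq)
  then show ?thesis
    using n_pos by (simp add: m_n field_simps power2_eq_square)
qed

text \<open>In terms of \<open>a\<close>, the threshold \<open>1 / (2 * m)\<close> is
  \<open>(a + 2) / (2 * a)\<close>, and \<open>c < a\<close> says precisely that
  \<open>\<beta>\<close> exceeds it.\<close>

lemma \<beta>_pos: "0 < \<beta>" and c_pos: "0 < c" and c_less_a: "c < a"
proof -
  have *: "(a + 2) / (2 * a) < \<beta>"
    using \<beta>_gt a_pos by (simp add: m_a field_simps)
  moreover have "0 < (a + 2) / (2 * a)"
    using a_pos by simp
  ultimately show "0 < \<beta>" by linarith
  then show "0 < c"
    using n_pos by (simp add: c_def)
  show "c < a"
    using * \<open>0 < \<beta>\<close> a_pos by (simp add: c_def n_a field_simps)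
qed

text \<open>With \<open>D = \<beta> * (N - 2)\<close>, the threshold for \<open>\<beta>\<close>
  reads \<open>a + 2 < D\<close>, equivalently \<open>(D - 4)\<^sup>2 < D\<^sup>2 - 8 * a\<close>.
  This one inequality makes the square root real and gives \<open>\<gamma> < 2\<close>.\<close>

lemma \<gamma>: "0 < \<gamma>" "\<gamma> < 2" "\<gamma>\<^sup>2 - \<beta> * (2 * a) * \<gamma> + 2 * a = 0"
proof -
  define D where "D = \<beta> * (2 * a)"
  define S where "S = sqrt (D\<^sup>2 - 8 * a)"
  have D: "a + 2 < D"
    using \<beta>_gt a_pos by (simp add: D_def m_a field_simps)
  have lower: "(D - 4)\<^sup>2 < D\<^sup>2 - 8 * a"
    using D by (simp add: power2_eq_square algebra_simps)
  then have S2: "S\<^sup>2 = D\<^sup>2 - 8 * a"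
    unfolding S_def by (intro real_sqrt_pow2) (smt (verit) zero_le_power2)
  have "sqrt ((D - 4)\<^sup>2) < S"
    unfolding S_def using lower by (rule real_sqrt_less_mono)
  then have S_gt: "\<bar>D - 4\<bar> < S" by simp
  have "S < D"
    using S2 a_pos D by (intro power2_less_imp_less[of S D]) auto
  moreover have \<gamma>: "\<gamma> = (D - S) / 2"
    by (simp add: \<gamma>_eq D_def S_def N_eq power_mult_distrib mult.assoc)
  ultimately show "0 < \<gamma>" "\<gamma> < 2"
    using S_gt by auto
  have "\<gamma>\<^sup>2 - D * \<gamma> + 2 * a = (S\<^sup>2 - (D\<^sup>2 - 8 * a)) / 4"
    by (simp add: \<gamma> power2_eq_square field_simps)
  then show "\<gamma>\<^sup>2 - \<beta> * (2 * a) * \<gamma> + 2 * a = 0"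
    by (simp add: S2 D_def)
qed

lemma exponents: "1 / m - 1 = 2 / a" "1 / m / (1 / m - 1) = 1 / n" "(1 / m - 1) * (\<gamma> * a / 2) = \<gamma>"
  using a_pos by (simp_all add: m_a n_a field_simps)

text \<open>The slope \<open>k = \<gamma> * a / 2\<close> is chosen so that the decay rate
  \<open>(p - 1) * k\<close> equals \<open>\<gamma>\<close>. Its quadratic is \<open>a / 2\<close>
  times the one for \<open>\<gamma>\<close>, and \<open>k < a\<close> is
  \<open>\<gamma> < 2\<close>.\<close>

sublocale profile_equation c \<kappa> \<beta> "1 / m" a "\<beta> * C" "\<gamma> * a / 2"
proof
  show "0 < \<kappa>"
    unfolding \<kappa>_def using c_pos c_less_a by (simp add: power_strict_mono)
  show "1 < 1 / m"
    using a_pos by (simp add: m_a)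
  show "c * (\<beta> * C) = a\<^sup>2"
    using \<beta>_pos n_pos by (simp add: c_def C)
  have "1 / m * (\<beta> * C) = \<beta> * (2 * a)"
    using n_pos a_pos by (simp add: C m_n power2_eq_square)
  then have "(2 / a) * (\<gamma> * a / 2)\<^sup>2 - 1 / m * (\<beta> * C) * (\<gamma> * a / 2) + a\<^sup>2 =
      a / 2 * (\<gamma>\<^sup>2 - \<beta> * (2 * a) * \<gamma> + 2 * a)"
    using a_pos by (simp add: field_simps power2_eq_square)
  then show "(1 / m - 1) * (\<gamma> * a / 2)\<^sup>2 - 1 / m * (\<beta> * C) * (\<gamma> * a / 2) + a\<^sup>2 = 0"
    unfolding exponents \<gamma>(3) by simp
qed (use c_pos \<beta>_pos a_pos \<gamma> in \<open>auto simp: \<kappa>_def\<close>)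

text \<open>These exponents give \<open>(profile v y) powr m = norm y powr (- a) * v (ln (norm y))\<close>, and since
  \<open>a = (N - 2) / 2\<close> no first-order term survives in the transformed Laplacian.\<close>

definition profile :: "(real \<Rightarrow> real) \<Rightarrow> 'a::euclidean_space \<Rightarrow> real" where
  "profile v y = norm y powr (- (2 / n)) * v (ln (norm y)) powr (1 / m)"

text \<open>Inverts \<open>profile\<close> along the ray through \<open>b\<close>, but returns
  \<open>v powr (1 / m)\<close> rather than \<open>v\<close>.\<close>

definition log_profile :: "'a::euclidean_space \<Rightarrow> ('a \<Rightarrow> real) \<Rightarrow> real \<Rightarrow> real" where
  "log_profile b h s = exp (2 / n * s) * h (exp s *\<^sub>R b)"

lemma radial_positive_solution_profile:
  assumes sol: "solution v e" and N_dim: "N = real DIM('a::euclidean_space)"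
  shows "radial_positive_solution m \<alpha> \<beta> (profile v :: 'a \<Rightarrow> real)"
  unfolding radial_positive_solution_def
proof (intro conjI allI impI)
  have v: "0 < v s" "(v has_real_derivative e s + c * v s - \<beta> * v s powr (1 / m)) (at s)"
      "(e has_real_derivative \<kappa> * v s - c * e s) (at s)" for s
    using sol by (auto simp: solution_def)
  show "radially_symmetric (profile v :: 'a \<Rightarrow> real)"
    by (simp add: radially_symmetric_def profile_def)
  show "0 < (profile v :: 'a \<Rightarrow> real) y" if "y \<noteq> 0" for y
    using that v(1)[of "ln (norm y)"] by (simp add: profile_def)
  show "smooth_on (profile v :: 'a \<Rightarrow> real) (- {0})"
    unfolding smooth_on_def profile_def
    using Ck_on_radial_solution[OF sol, where 'a='a]
    by (auto intro!: Ck_on_mult)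
  fix y :: 'a assume y: "y \<noteq> 0"
  define w where "w s = v s powr (1 / m)" for s
  define v1 where "v1 s = e s + c * v s - \<beta> * w s" for s
  define w1 where "w1 s = 1 / m * v s powr (1 / m - 1) * v1 s" for s
  define v2 where "v2 s = \<kappa> * v s - c * e s + c * v1 s - \<beta> * w1 s" for s
  have dv: "(v has_real_derivative v1 s) (at s)" for s
    using v(2) by (simp add: v1_def w_def)
  have dw: "(w has_real_derivative w1 s) (at s)" for s
    unfolding w_def[abs_def] w1_def
    by (rule DERIV_chain2[OF has_real_derivative_powr[OF v(1)] dv])
  have dv1: "(v1 has_real_derivative v2 s) (at s)" for s
    unfolding v1_def[abs_def] v2_def
    by (auto intro!: derivative_eq_intros v(3) dv dw simp: v1_def)
  define r where "r = norm y"
  have r: "0 < r" using y by (simp add: r_def)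
  define s where "s = ln r"
  have G: "profile v y powr m = norm y powr (- a) * v (ln (norm y))" if "y \<noteq> 0" for y :: 'a
  proof -
    have "2 / n * m = a"
      using a_pos by (simp add: two_n m_a)
    then have "- (2 / n) * m = - a"
      by (simp only: mult_minus_left)
    then show ?thesis
      using that v(1)[of "ln (norm y)"] m_pos by (simp add: profile_def powr_mult powr_powr less_imp_le)
  qed
  define G1 where "G1 t = v1 t - a * v t" for t
  define G2 where "G2 t = v2 t - a * v1 t" for t
  have "laplacian (\<lambda>x::'a. profile v x powr m) y =
      norm y powr (- a - 1 - 1) * ((- a - 1) * G1 (ln (norm y)) + G2 (ln (norm y))) +
      (real DIM('a) - 1) / norm y * (norm y powr (- a - 1) * G1 (ln (norm y)))"
  proof (rule laplacian_radial[OF y])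
    show "profile v x powr m = norm x powr (- a) * v (ln (norm x))" if "x \<noteq> 0" for x :: 'a
      using G[OF that] .
    show "((\<lambda>r. r powr - a * v (ln r)) has_real_derivative r powr (- a - 1) * G1 (ln r)) (at r)"
      if "0 < r" for r
      using DERIV_powr_mult_ln[OF dv that, of "- a"] by (simp add: G1_def)
    have "(G1 has_real_derivative G2 t) (at t)" for t
      unfolding G1_def[abs_def] G2_def by (auto intro!: derivative_eq_intros dv dv1)
    from DERIV_powr_mult_ln[OF this]
    show "((\<lambda>r. r powr (- a - 1) * G1 (ln r)) has_real_derivative
        r powr (- a - 1 - 1) * ((- a - 1) * G1 (ln r) + G2 (ln r))) (at r)" if "0 < r" for r
      using that by blast
  qed
  also have "\<dots> = r powr (- a - 2) * ((- a - 1) * G1 s + G2 s) + r powr (- a - 2) * ((2 * a + 1) * G1 s)"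
  proof -
    have "real DIM('a) - 1 = 2 * a + 1"
      using N_dim N_eq by simp
    moreover have base: "r powr (- a - 1) = r * r powr (- a - 2)"
      using r by (simp add: powr_diff power2_eq_square)
    have "(2 * a + 1) / r * (r powr (- a - 1) * G1 s) = r powr (- a - 2) * ((2 * a + 1) * G1 s)"
      unfolding base using r by simp
    moreover have "- a - 1 - 1 = - a - 2"
      by simp
    ultimately show ?thesis
      unfolding r_def[symmetric] s_def[symmetric] by (simp only:)
  qed
  finally have lap: "laplacian (\<lambda>x::'a. profile v x powr m) y = r powr (- a - 2) * (v2 s - a\<^sup>2 * v s)"
    by (simp add: G1_def G2_def algebra_simps power2_eq_square)
  have "y \<bullet> grad (profile v) y = norm y *
      (norm y powr (- (2 / n) - 1) * (- (2 / n) * w (ln (norm y)) + w1 (ln (norm y))))"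
  proof (rule inner_grad_radial[OF y])
    show "((\<lambda>r. r powr (- (2 / n)) * w (ln r)) has_real_derivative
        norm y powr (- (2 / n) - 1) * (- (2 / n) * w (ln (norm y)) + w1 (ln (norm y)))) (at (norm y))"
      using y by (intro DERIV_powr_mult_ln dw) auto
  qed (simp add: profile_def w_def)
  also have "\<dots> = r powr (- a - 2) * (w1 s - (a + 2) * w s)"
  proof -
    have "1 + (- (a + 2) - 1) = - a - 2"
      by simp
    then have base: "r * r powr (- (a + 2) - 1) = r powr (- a - 2)"
      using powr_mult_base[of r "- (a + 2) - 1"] r by (simp only: less_imp_le)
    have "- (a + 2) * w s + w1 s = w1 s - (a + 2) * w s"
      by (simp add: algebra_simps)
    then show ?thesis
      unfolding two_n r_def[symmetric] s_def[symmetric] mult.assoc[symmetric] base by (simp only:)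
  qed
  finally have gr: "y \<bullet> grad (profile v) y = r powr (- a - 2) * (w1 s - (a + 2) * w s)" .
  have "- (2 / n) = - a - 2" by (simp add: two_n)
  then have "profile v y = r powr (- a - 2) * w s"
    by (simp add: profile_def w_def r_def s_def)
  then have "laplacian (\<lambda>x. profile v x powr m) y + \<beta> * (y \<bullet> grad (profile v) y) + \<alpha> * profile v y =
      r powr (- a - 2) * (v2 s - a\<^sup>2 * v s + \<beta> * (w1 s - (a + 2) * w s) + \<alpha> * w s)"
    unfolding lap gr by (simp add: algebra_simps)
  \<comment> \<open>Only a multiple of \<open>w s\<close> is left, and its coefficient vanishes
    because \<open>c * \<beta> = 1 / n\<close> and
    \<open>\<alpha> = 2 * \<beta> / n + 1 / n\<close>.\<close>
  also have "v2 s - a\<^sup>2 * v s + \<beta> * (w1 s - (a + 2) * w s) + \<alpha> * w s =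
      (\<alpha> - \<beta> * (a + 2) - c * \<beta>) * w s"
    unfolding v2_def v1_def \<kappa>_def by (simp add: algebra_simps power2_eq_square)
  also have "\<alpha> - \<beta> * (a + 2) - c * \<beta> = 0"
    using \<beta>_pos a_pos by (simp add: \<alpha>_eq c_def n_a field_simps)
  finally show "laplacian (\<lambda>x. profile v x powr m) y + \<beta> * (y \<bullet> grad (profile v) y) +
      \<alpha> * profile v y = 0" by simp
qed

text \<open>This converse makes the uniqueness result apply to arbitrary profiles and not just to
  constructed ones. The first equation serves to define \<open>e\<close>; the second is then the
  radial form of the partial differential equation.\<close>

lemma solution_log_profile:
  fixes h :: "'a::euclidean_space \<Rightarrow> real"
  assumes h: "radial_positive_solution m \<alpha> \<beta> h" and N_dim: "N = real DIM('a)"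
    and b: "b \<in> Basis"
  obtains e where "solution (\<lambda>s. log_profile b h s powr m) e"
proof -
  have sym: "h x = h y" if "x \<noteq> 0" "y \<noteq> 0" "norm x = norm y" for x y
    using h that unfolding radial_positive_solution_def radially_symmetric_def by blast
  have hpos: "0 < h y" if "y \<noteq> 0" for y
    using h that by (simp add: radial_positive_solution_def)
  have "smooth_on h (- {0})"
    using h by (simp add: radial_positive_solution_def)
  then have "Ck_on (Suc (Suc 0)) h (- {0})"
    unfolding smooth_on_def by blast
  then have diff: "h differentiable (at y)" "partial b h differentiable (at y)" if "y \<noteq> 0" for y
    using that b by auto
  have b0: "b \<noteq> 0" "norm b = 1" using b by auto
  define f where "f r = h (r *\<^sub>R b)" for r
  define f1 where "f1 r = partial b h (r *\<^sub>R b)" for r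
  define f2 where "f2 r = partial b (partial b h) (r *\<^sub>R b)" for r
  have fpos: "0 < f r" and df: "(f has_real_derivative f1 r) (at r)"
    and df1: "(f1 has_real_derivative f2 r) (at r)" if "0 < r" for r
    using that b0 hpos diff DERIV_along_ray[of h r b] DERIV_along_ray[of "partial b h" r b]
    by (auto simp: f_def[abs_def] f1_def[abs_def] f2_def)
  have hf: "h y = f (norm y)" if "y \<noteq> 0" for y
    unfolding f_def using that b0 by (intro sym) auto
  define F where "F r = f r powr m" for r
  define F1 where "F1 r = m * f r powr (m - 1) * f1 r" for r
  define F2 where "F2 r = m * ((m - 1) * f r powr (m - 2) * f1 r * f1 r + f r powr (m - 1) * f2 r)" for r
  have dF: "(F has_real_derivative F1 r) (at r)" if "0 < r" for r
    unfolding F_def[abs_def] F1_def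
    using DERIV_chain2[OF has_real_derivative_powr[OF fpos[OF that]] df[OF that]] .
  have dF1: "(F1 has_real_derivative F2 r) (at r)" if "0 < r" for r
  proof -
    have "((\<lambda>r. f r powr (m - 1)) has_real_derivative (m - 1) * f r powr (m - 1 - 1) * f1 r) (at r)"
      using DERIV_chain2[OF has_real_derivative_powr[OF fpos[OF that]] df[OF that]] .
    from DERIV_mult[OF DERIV_cmult[OF this, of m] df1[OF that]] show ?thesis
      unfolding F1_def[abs_def] F2_def by (rule DERIV_cong) (simp add: algebra_simps)
  qed
  have pde: "F2 r + (2 * a + 1) / r * F1 r + \<beta> * (r * f1 r) + \<alpha> * f r = 0" if r: "0 < r" for r
  proof -
    let ?y = "r *\<^sub>R b"
    have y: "?y \<noteq> 0" "norm ?y = r" using r b0 by auto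
    have "laplacian (\<lambda>x. h x powr m) ?y + \<beta> * (?y \<bullet> grad h ?y) + \<alpha> * h ?y = 0"
      using h y(1) unfolding radial_positive_solution_def by blast
    moreover have "laplacian (\<lambda>x. h x powr m) ?y = F2 r + (real DIM('a) - 1) / r * F1 r"
      using laplacian_radial[OF y(1) dF dF1, of "\<lambda>x. h x powr m"] hf y(2) by (simp add: F_def)
    moreover have "?y \<bullet> grad h ?y = r * f1 r"
      using inner_grad_radial[OF y(1), of f "f1 r" h] df[OF r] hf y(2) by simp
    moreover have "real DIM('a) - 1 = 2 * a + 1"
      using N_dim N_eq by simp
    ultimately show ?thesis
      using r by (simp add: f_def)
  qed
  define w where "w s = log_profile b h s" for s
  have w: "w s = exp ((a + 2) * s) * f (exp s)" for s
    by (simp add: w_def log_profile_def f_def two_n)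
  have wpos: "0 < w s" for s
    using fpos by (simp add: w)
  define v where "v s = w s powr m" for s
  have v: "v s = exp (a * s) * F (exp s)" for s
  proof -
    have "(a + 2) * m = a" using a_pos by (simp add: m_a)
    then have "(a + 2) * s * m = a * s" by (simp add: mult.commute mult.left_commute)
    then show ?thesis
      using fpos[of "exp s"] by (simp add: v_def w F_def powr_mult exp_powr_real less_imp_le)
  qed
  define v1 where "v1 s = exp (a * s) * (a * F (exp s) + exp s * F1 (exp s))" for s
  define v2 where "v2 s = exp (a * s) * (a\<^sup>2 * F (exp s) + (2 * a + 1) * (exp s * F1 (exp s))
      + exp s * exp s * F2 (exp s))" for s
  define w1 where "w1 s = exp ((a + 2) * s) * ((a + 2) * f (exp s) + exp s * f1 (exp s))" for s
  have chain: "((\<lambda>s. g (exp s)) has_real_derivative g' (exp s) * exp s) (at s)"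
    if "\<And>r. 0 < r \<Longrightarrow> (g has_real_derivative g' r) (at r)" for g g' s
    using DERIV_chain2[OF that[OF exp_gt_zero] DERIV_exp] .
  have dv: "(v has_real_derivative v1 s) (at s)" for s
    unfolding v[abs_def] v1_def
    by (auto intro!: derivative_eq_intros chain[OF dF] simp: algebra_simps)
  have dv1: "(v1 has_real_derivative v2 s) (at s)" for s
    unfolding v1_def[abs_def] v2_def
    by (auto intro!: derivative_eq_intros chain[OF dF] chain[OF dF1] simp: algebra_simps power2_eq_square)
  have dw: "(w has_real_derivative w1 s) (at s)" for s
    unfolding w[abs_def] w1_def
    by (auto intro!: derivative_eq_intros chain[OF df] simp: algebra_simps)
  define e where "e s = v1 s - c * v s + \<beta> * w s" for s
  have vw: "v s powr (1 / m) = w s" for s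
    using m_pos wpos[of s] by (simp add: v_def powr_powr)
  have "(e has_real_derivative v2 s - c * v1 s + \<beta> * w1 s) (at s)" for s
    unfolding e_def[abs_def] by (auto intro!: derivative_eq_intros dv dv1 dw)
  moreover have "v2 s - c * v1 s + \<beta> * w1 s = \<kappa> * v s - c * e s" for s
  proof -
    define r where "r = exp s"
    have r: "0 < r" by (simp add: r_def)
    have "exp ((a + 2) * s) = exp (a * s) * r * r"
      by (simp add: r_def algebra_simps flip: exp_add)
    then have "v2 s - a\<^sup>2 * v s + \<beta> * w1 s + c * \<beta> * w s =
        exp (a * s) * r * r * (F2 r + (2 * a + 1) / r * F1 r + \<beta> * (r * f1 r) + (\<beta> * (a + 2) + c * \<beta>) * f r)"
      using r unfolding v2_def v w1_def w r_def[symmetric] by (simp add: field_simps)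
    moreover have "\<beta> * (a + 2) + c * \<beta> = \<alpha>"
      using \<beta>_pos a_pos by (simp add: \<alpha>_eq c_def n_a field_simps)
    ultimately have "v2 s - a\<^sup>2 * v s + \<beta> * w1 s + c * \<beta> * w s = 0"
      using pde[OF r] by simp
    then show ?thesis
      by (simp add: e_def \<kappa>_def algebra_simps power2_eq_square)
  qed
  ultimately have "(e has_real_derivative \<kappa> * v s - c * e s) (at s)" for s
    by metis
  moreover have "0 < v s" for s
    using wpos[of s] by (simp add: v_def)
  moreover have "e s + c * v s - \<beta> * w s = v1 s" for s
    by (simp add: e_def)
  ultimately have "solution v e"
    unfolding solution_def vw using dv by simp
  then show thesis
    using that by (simp add: v_def[abs_def] w_def)
qed

text \<open>Hence the rate \<open>\<alpha> / \<beta>\<close> at the origin is the decay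
  \<open>exp (- c * s)\<close> of \<open>v powr (1 / m)\<close>, once the factor
  \<open>norm y powr (- (2 / n))\<close> is split off.\<close>

lemma alpha_beta: "\<alpha> / \<beta> = 2 / n + c"
  using \<beta>_pos n_pos by (simp add: \<alpha>_eq c_def field_simps)

lemma C_pos: "0 < C"
  using a_pos n_pos by (simp add: C)

section \<open>Correspondence between the expansions of profiles and limits in
  \<open>s\<close>\<close>

lemma asymptotics_at_zero_profile:
  assumes "((\<lambda>s. v s powr (1 / m) * exp (c * s)) \<longlongrightarrow> K) at_bot" "0 < K"
  shows "asymptotics_at_zero \<alpha> \<beta> K (profile v :: 'a::euclidean_space \<Rightarrow> real)"
proof -
  define f where "f s = v s powr (1 / m) * exp (c * s) / K - 1" for s
  define err where "err = (\<lambda>y::'a. f (ln (norm y)))"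
  have "((\<lambda>s. v s powr (1 / m) * exp (c * s) / K - 1) \<longlongrightarrow> K / K - 1) at_bot"
    using assms by (intro tendsto_intros) auto
  then have "(f \<longlongrightarrow> 0) at_bot"
    using assms(2) by (simp add: f_def[abs_def])
  moreover have "filterlim (\<lambda>y::'a. ln (norm y)) at_bot (at 0)"
    by (rule filterlim_ln_norm_at_0)
  ultimately have "(err \<longlongrightarrow> 0) (at 0)"
    unfolding err_def by (rule filterlim_compose)
  then have "err \<in> o[at 0](\<lambda>_. 1)"
    by (intro smalloI_tendsto) auto
  moreover have "profile v y = K * norm y powr (- (\<alpha> / \<beta>)) * (1 + err y)" if "y \<noteq> 0" for y :: 'a
  proof -
    have "exp (c * ln (norm y)) = norm y powr c"
      using that by (simp add: powr_def)
    then have "K * norm y powr (- (\<alpha> / \<beta>)) * (1 + err y) =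
        (norm y powr (- (\<alpha> / \<beta>)) * norm y powr c) * v (ln (norm y)) powr (1 / m)"
      using assms(2) by (simp add: err_def f_def)
    also have "norm y powr (- (\<alpha> / \<beta>)) * norm y powr c = norm y powr (- (2 / n))"
      unfolding alpha_beta by (simp flip: powr_add)
    finally show ?thesis by (simp add: profile_def)
  qed
  then have "\<forall>\<^sub>F y in at 0. (profile v :: 'a \<Rightarrow> real) y = K * norm y powr (- (\<alpha> / \<beta>)) * (1 + err y)"
    by (auto simp: eventually_at_filter)
  ultimately show ?thesis
    unfolding asymptotics_at_zero_def by blast
qed

lemma powr_scale: "0 < r \<Longrightarrow> (C / r\<^sup>2) powr (1 / n) = C powr (1 / n) * r powr (- (2 / n))"
proof -
  assume r: "0 < r"
  have "r\<^sup>2 powr (1 / n) = r powr (2 / n)"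
    unfolding powr_numeral[OF less_imp_le[OF r], symmetric] by (simp add: powr_powr)
  then show ?thesis
    using C_pos by (simp add: powr_divide powr_minus_divide)
qed

lemma asymptotics_at_infinity_profile:
  assumes "((\<lambda>s. (v s powr (1 / m) / C powr (1 / n) - 1) * exp (\<gamma> * s)) \<longlongrightarrow> B) at_top"
  shows "asymptotics_at_infinity C n B \<gamma> (profile v :: 'a::euclidean_space \<Rightarrow> real)"
proof -
  define f where "f s = (v s powr (1 / m) / C powr (1 / n) - 1) * exp (\<gamma> * s) - B" for s
  define err where "err = (\<lambda>y::'a. norm y powr (- \<gamma>) * f (ln (norm y)))"
  have "(f \<longlongrightarrow> B - B) at_top"
    unfolding f_def[abs_def] by (intro tendsto_intros assms)
  then have "(f \<longlongrightarrow> 0) at_top" by simp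
  moreover have "filterlim (\<lambda>y::'a. ln (norm y)) at_top at_infinity"
    by (rule filterlim_compose[OF ln_at_top filterlim_norm_at_top])
  ultimately have "((\<lambda>y::'a. f (ln (norm y))) \<longlongrightarrow> 0) at_infinity"
    by (rule filterlim_compose)
  moreover have nz: "\<forall>\<^sub>F y::'a in at_infinity. y \<noteq> 0"
    by (auto simp: eventually_at_infinity intro!: exI[of _ 1])
  have "\<forall>\<^sub>F y in at_infinity. f (ln (norm y)) = err y / norm y powr (- \<gamma>)"
    using nz by eventually_elim (simp add: err_def)
  ultimately have "((\<lambda>y. err y / norm y powr (- \<gamma>)) \<longlongrightarrow> 0) at_infinity"
    by (rule Lim_transform_eventually)
  then have "err \<in> o[at_infinity](\<lambda>y. norm y powr (- \<gamma>))"
    by (rule smalloI_tendsto) (use nz in eventually_elim, auto)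
  moreover have "\<forall>\<^sub>F y::'a in at_infinity.
      profile v y = (C / (norm y)\<^sup>2) powr (1 / n) * (1 + B * norm y powr (- \<gamma>) + err y)"
    using nz
  proof eventually_elim
    case (elim y)
    have "norm y powr (- \<gamma>) * exp (\<gamma> * ln (norm y)) = 1"
      using elim by (simp add: powr_def flip: exp_add)
    then have "1 + B * norm y powr (- \<gamma>) + err y = v (ln (norm y)) powr (1 / m) / C powr (1 / n)"
      by (simp add: err_def f_def algebra_simps)
    then show ?case
      using elim C_pos by (simp add: powr_scale profile_def)
  qed
  ultimately show ?thesis
    unfolding asymptotics_at_infinity_def by blast
qed

lemma log_profile_at_bot:
  fixes h :: "'a::euclidean_space \<Rightarrow> real"
  assumes "asymptotics_at_zero \<alpha> \<beta> K h" and b: "b \<in> Basis"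
  shows "((\<lambda>s. log_profile b h s * exp (c * s)) \<longlongrightarrow> K) at_bot"
proof -
  obtain err where err: "err \<in> o[at 0](\<lambda>_. 1)"
      "\<forall>\<^sub>F y in at 0. h y = K * norm y powr (- (\<alpha> / \<beta>)) * (1 + err y)"
    using assms unfolding asymptotics_at_zero_def by blast
  have ray: "filterlim (\<lambda>s. exp s *\<^sub>R b) (at 0) at_bot"
    unfolding filterlim_at using tendsto_scaleR[OF exp_at_bot tendsto_const[of b]] nonzero_Basis[OF b]
    by simp
  have "(err \<longlongrightarrow> 0) (at 0)"
    using smalloD_tendsto[OF err(1)] by simp
  then have "((\<lambda>s. err (exp s *\<^sub>R b)) \<longlongrightarrow> 0) at_bot"
    by (rule filterlim_compose[OF _ ray])
  then have "((\<lambda>s. K * (1 + err (exp s *\<^sub>R b))) \<longlongrightarrow> K * (1 + 0)) at_bot"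
    by (intro tendsto_intros)
  moreover have "\<forall>\<^sub>F s in at_bot. K * (1 + err (exp s *\<^sub>R b)) = log_profile b h s * exp (c * s)"
    using eventually_compose_filterlim[OF err(2) ray]
  proof eventually_elim
    case (elim s)
    have "exp (2 / n * s) * exp s powr (- (\<alpha> / \<beta>)) * exp (c * s) = 1"
      unfolding alpha_beta by (simp add: exp_powr_real algebra_simps flip: exp_add)
    moreover have "norm (exp s *\<^sub>R b) = exp s"
      using b by simp
    then have "log_profile b h s * exp (c * s) =
        exp (2 / n * s) * exp s powr (- (\<alpha> / \<beta>)) * exp (c * s) * (K * (1 + err (exp s *\<^sub>R b)))"
      unfolding log_profile_def elim by (simp only: mult_ac)
    ultimately show ?case
      by (simp only: mult_1_left)
  qed
  ultimately show ?thesis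
    using Lim_transform_eventually by fastforce
qed

lemma log_profile_at_top:
  fixes h :: "'a::euclidean_space \<Rightarrow> real"
  assumes "asymptotics_at_infinity C n B \<gamma> h" and b: "b \<in> Basis"
  shows "((\<lambda>s. (log_profile b h s / C powr (1 / n) - 1) * exp (\<gamma> * s)) \<longlongrightarrow> B) at_top"
proof -
  obtain err where err: "err \<in> o[at_infinity](\<lambda>y. norm y powr (- \<gamma>))"
      "\<forall>\<^sub>F y in at_infinity. h y = (C / (norm y)\<^sup>2) powr (1 / n) * (1 + B * norm y powr (- \<gamma>) + err y)"
    using assms unfolding asymptotics_at_infinity_def by blast
  have ray: "filterlim (\<lambda>s. exp s *\<^sub>R b) at_infinity at_top"
    using b by (intro filterlim_norm_at_top_imp_at_infinity) (simp add: exp_at_top)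
  have "((\<lambda>y. err y / norm y powr (- \<gamma>)) \<longlongrightarrow> 0) at_infinity"
    using smalloD_tendsto[OF err(1)] .
  then have "((\<lambda>s. err (exp s *\<^sub>R b) / norm (exp s *\<^sub>R b) powr (- \<gamma>)) \<longlongrightarrow> 0) at_top"
    by (rule filterlim_compose[OF _ ray])
  then have "((\<lambda>s. B + err (exp s *\<^sub>R b) / norm (exp s *\<^sub>R b) powr (- \<gamma>)) \<longlongrightarrow> B + 0) at_top"
    by (intro tendsto_intros)
  moreover have "\<forall>\<^sub>F s in at_top. B + err (exp s *\<^sub>R b) / norm (exp s *\<^sub>R b) powr (- \<gamma>) =
      (log_profile b h s / C powr (1 / n) - 1) * exp (\<gamma> * s)"
    using eventually_compose_filterlim[OF err(2) ray]
  proof eventually_elim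
    case (elim s)
    define E where "E = err (exp s *\<^sub>R b)"
    have nb: "norm (exp s *\<^sub>R b) = exp s" using b by simp
    have "log_profile b h s = exp (2 / n * s) * (C powr (1 / n) * exp s powr (- (2 / n)) *
        (1 + B * exp s powr (- \<gamma>) + E))"
      unfolding log_profile_def elim nb powr_scale[OF exp_gt_zero] E_def ..
    also have "\<dots> = C powr (1 / n) * (1 + B * exp (- \<gamma> * s) + E) * (exp (2 / n * s) * exp (- (2 / n) * s))"
      by (simp add: exp_powr_real mult_ac)
    also have "exp (2 / n * s) * exp (- (2 / n) * s) = 1"
      by (simp flip: exp_add)
    finally have "log_profile b h s / C powr (1 / n) = 1 + B * exp (- \<gamma> * s) + E"
      using C_pos by simp
    then have "(log_profile b h s / C powr (1 / n) - 1) * exp (\<gamma> * s) =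
        B * (exp (- \<gamma> * s) * exp (\<gamma> * s)) + E * exp (\<gamma> * s)"
      by (simp add: algebra_simps)
    also have "exp (- \<gamma> * s) * exp (\<gamma> * s) = 1"
      by (simp flip: exp_add)
    finally show ?case
      unfolding nb E_def by (simp add: exp_powr_real exp_minus divide_inverse)
  qed
  ultimately show ?thesis
    using Lim_transform_eventually by fastforce
qed

section \<open>Translation in \<open>s\<close>; existence and uniqueness of profiles\<close>

lemma solution_shift: "solution v e \<Longrightarrow> solution (\<lambda>s. v (s + t)) (\<lambda>s. e (s + t))"
  unfolding solution_def by (intro allI conjI DERIV_shift[THEN iffD1]) auto

lemma shift_at_bot:
  fixes f :: "real \<Rightarrow> real"
  assumes "((\<lambda>s. f s * exp (r * s)) \<longlongrightarrow> L) at_bot"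
  shows "((\<lambda>s. f (s + t) * exp (r * s)) \<longlongrightarrow> L * exp (- (r * t))) at_bot"
proof -
  have "filterlim (\<lambda>s. t + s) at_bot at_bot"
    unfolding filterlim_at_bot
  proof
    show "\<forall>\<^sub>F s in at_bot. t + s \<le> Z" for Z
      using eventually_le_at_bot[of "Z - t"] by eventually_elim simp
  qed
  from filterlim_compose[OF assms this]
  have "((\<lambda>s. f (t + s) * exp (r * (t + s)) * exp (- (r * t))) \<longlongrightarrow> L * exp (- (r * t))) at_bot"
    by (intro tendsto_intros)
  then show ?thesis
    by (simp add: algebra_simps mult.assoc[symmetric] flip: exp_add)
qed

lemma shift_at_top:
  fixes f :: "real \<Rightarrow> real"
  assumes "((\<lambda>s. f s * exp (r * s)) \<longlongrightarrow> L) at_top"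
  shows "((\<lambda>s. f (s + t) * exp (r * s)) \<longlongrightarrow> L * exp (- (r * t))) at_top"
proof -
  have "filterlim (\<lambda>s. t + s) at_top at_top"
    unfolding filterlim_at_top
  proof
    show "\<forall>\<^sub>F s in at_top. Z \<le> t + s" for Z
      using eventually_ge_at_top[of "Z - t"] by eventually_elim simp
  qed
  from filterlim_compose[OF assms this]
  have "((\<lambda>s. f (t + s) * exp (r * (t + s)) * exp (- (r * t))) \<longlongrightarrow> L * exp (- (r * t))) at_top"
    by (intro tendsto_intros)
  then show ?thesis
    by (simp add: algebra_simps mult.assoc[symmetric] flip: exp_add)
qed

lemma profile_exists:
  assumes N_dim: "N = real DIM('a::euclidean_space)" and B: "0 < B"
  obtains g :: "'a::euclidean_space \<Rightarrow> real" where "is_profile m n C \<alpha> \<beta> \<gamma> B g"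
proof -
  obtain v e where v: "solution v e"
      "((\<lambda>s. \<beta> * v s powr (1 / m) * exp (c * s)) \<longlongrightarrow> 1) at_bot"
    by (rule singular_solution_exists)
  interpret singular_solution c \<kappa> \<beta> "1 / m" a "\<beta> * C" "\<gamma> * a / 2" v e
    by unfold_locales (use v in auto)
  obtain B0 where B0: "0 < B0"
      "((\<lambda>s. (v s powr (1 / m) / (\<beta> * C / \<beta>) powr (1 / m / (1 / m - 1)) - 1) *
        exp ((1 / m - 1) * (\<gamma> * a / 2) * s)) \<longlongrightarrow> B0) at_top"
    by (rule asymptotics_at_top)
  have top: "((\<lambda>s. (v s powr (1 / m) / C powr (1 / n) - 1) * exp (\<gamma> * s)) \<longlongrightarrow> B0) at_top"
    using B0(2) \<beta>_pos unfolding exponents(2,3) by simp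
  \<comment> \<open>Translation by \<open>t\<close> multiplies the coefficient at infinity by
    \<open>exp (- (\<gamma> * t))\<close>; this \<open>t\<close> takes \<open>B0\<close> to
    \<open>B\<close>, both being positive.\<close>
  define t where "t = ln (B0 / B) / \<gamma>"
  have "B0 * exp (- (\<gamma> * t)) = B"
    using B0(1) B \<gamma>(1) by (simp add: t_def exp_minus)
  with shift_at_top[OF top, of t]
  have top': "((\<lambda>s. (v (s + t) powr (1 / m) / C powr (1 / n) - 1) * exp (\<gamma> * s)) \<longlongrightarrow> B) at_top"
    by simp
  have "((\<lambda>s. 1 / \<beta> * (\<beta> * v s powr (1 / m) * exp (c * s))) \<longlongrightarrow> 1 / \<beta> * 1) at_bot"
    by (intro tendsto_intros v)
  then have "((\<lambda>s. v s powr (1 / m) * exp (c * s)) \<longlongrightarrow> 1 / \<beta>) at_bot"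
    using \<beta>_pos by simp
  from shift_at_bot[OF this, of t]
  have bot': "((\<lambda>s. v (s + t) powr (1 / m) * exp (c * s)) \<longlongrightarrow> 1 / \<beta> * exp (- (c * t))) at_bot" .
  have "is_profile m n C \<alpha> \<beta> \<gamma> B (profile (\<lambda>s. v (s + t)) :: 'a \<Rightarrow> real)"
    unfolding is_profile_def
  proof (intro conjI exI)
    show "radial_positive_solution m \<alpha> \<beta> (profile (\<lambda>s. v (s + t)) :: 'a \<Rightarrow> real)"
      using solution_shift[OF v(1)] N_dim by (rule radial_positive_solution_profile)
    show "asymptotics_at_infinity C n B \<gamma> (profile (\<lambda>s. v (s + t)) :: 'a \<Rightarrow> real)"
      using top' by (rule asymptotics_at_infinity_profile)
    show pos: "0 < 1 / \<beta> * exp (- (c * t))"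
      using \<beta>_pos by simp
    show "asymptotics_at_zero \<alpha> \<beta> (1 / \<beta> * exp (- (c * t))) (profile (\<lambda>s. v (s + t)) :: 'a \<Rightarrow> real)"
      using bot' pos by (rule asymptotics_at_zero_profile)
  qed
  then show thesis by (rule that)
qed

text \<open>The constants \<open>Kg\<close> and \<open>Kh\<close> at the origin may differ a priori.
  A translation of \<open>h\<close> makes them agree, so the translated solutions coincide;
  comparing the coefficients at infinity, both \<open>B\<close>, then forces the translation to be
  0.\<close>

lemma profile_unique:
  fixes g h :: "'a::euclidean_space \<Rightarrow> real"
  assumes N_dim: "N = real DIM('a)" and B: "0 < B"
    and g: "is_profile m n C \<alpha> \<beta> \<gamma> B g" and h: "is_profile m n C \<alpha> \<beta> \<gamma> B h"
    and y: "y \<noteq> 0"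
  shows "h y = g y"
proof -
  obtain b :: 'a where b: "b \<in> Basis"
    using nonempty_Basis by blast
  have b0: "b \<noteq> 0" "norm b = 1" using b by auto
  have pos: "0 < f x" if "is_profile m n C \<alpha> \<beta> \<gamma> B f" "x \<noteq> 0" for f :: "'a \<Rightarrow> real" and x
    using that by (simp add: is_profile_def radial_positive_solution_def)
  have inv: "(log_profile b f s powr m) powr (1 / m) = log_profile b f s"
    if "is_profile m n C \<alpha> \<beta> \<gamma> B f" for f :: "'a \<Rightarrow> real" and s
    using pos[OF that] b0 m_pos by (simp add: log_profile_def powr_powr less_imp_le)
  obtain Kg Kh where K: "0 < Kg" "asymptotics_at_zero \<alpha> \<beta> Kg g" "0 < Kh" "asymptotics_at_zero \<alpha> \<beta> Kh h"
    using g h unfolding is_profile_def by blast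
  have sols: "radial_positive_solution m \<alpha> \<beta> g" "radial_positive_solution m \<alpha> \<beta> h"
    and infs: "asymptotics_at_infinity C n B \<gamma> g" "asymptotics_at_infinity C n B \<gamma> h"
    using g h by (auto simp: is_profile_def)
  obtain eg where eg: "solution (\<lambda>s. log_profile b g s powr m) eg"
    by (rule solution_log_profile[OF sols(1) N_dim b])
  obtain eh where eh: "solution (\<lambda>s. log_profile b h s powr m) eh"
    by (rule solution_log_profile[OF sols(2) N_dim b])
  define t where "t = ln (Kh / Kg) / c"
  have "Kh * exp (- (c * t)) = Kg"
    using K c_pos by (simp add: t_def exp_minus)
  with shift_at_bot[OF log_profile_at_bot[OF K(4) b], of t]
  have lim_h: "((\<lambda>s. log_profile b h (s + t) * exp (c * s)) \<longlongrightarrow> Kg) at_bot"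
    by simp
  have eq: "log_profile b g s = log_profile b h (s + t)" for s
  proof -
    have "log_profile b g s powr m = log_profile b h (s + t) powr m"
    proof (rule singular_solution_unique[OF eg solution_shift[OF eh, of t] _ _ K(1)])
      show "((\<lambda>s. (log_profile b g s powr m) powr (1 / m) * exp (c * s)) \<longlongrightarrow> Kg) at_bot"
        unfolding inv[OF g] by (rule log_profile_at_bot[OF K(2) b])
      show "((\<lambda>s. (log_profile b h (s + t) powr m) powr (1 / m) * exp (c * s)) \<longlongrightarrow> Kg) at_bot"
        unfolding inv[OF h] by (rule lim_h)
    qed
    then have "(log_profile b g s powr m) powr (1 / m) = (log_profile b h (s + t) powr m) powr (1 / m)"
      by (simp only:)
    then show ?thesis
      unfolding inv[OF g] inv[OF h] .
  qed
  have "((\<lambda>s. (log_profile b g s / C powr (1 / n) - 1) * exp (\<gamma> * s)) \<longlongrightarrow> B * exp (- (\<gamma> * t))) at_top"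
    unfolding eq by (rule shift_at_top[OF log_profile_at_top[OF infs(2) b]])
  then have "B * exp (- (\<gamma> * t)) = B"
    using log_profile_at_top[OF infs(1) b] by (rule tendsto_unique[rotated]) simp
  then have "t = 0"
    using B \<gamma>(1) by simp
  have ray: "f y = norm y powr (- (2 / n)) * log_profile b f (ln (norm y))"
    if "radial_positive_solution m \<alpha> \<beta> f" for f :: "'a \<Rightarrow> real"
  proof -
    have "radially_symmetric f"
      using that by (simp add: radial_positive_solution_def)
    then have "f y = f (norm y *\<^sub>R b)"
      unfolding radially_symmetric_def using y b0 by (elim allE[of _ y] allE[of _ "norm y *\<^sub>R b"]) auto
    moreover have "exp (2 / n * ln (norm y)) = norm y powr (2 / n)" "exp (ln (norm y)) = norm y"
      using y by (simp_all add: powr_def)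
    moreover have "norm y powr (- (2 / n)) * norm y powr (2 / n) = 1"
      using y by (simp flip: powr_add)
    ultimately show ?thesis
      unfolding log_profile_def by (simp only: mult.assoc[symmetric] mult_1_left)
  qed
  show ?thesis
    unfolding ray[OF sols(1)] ray[OF sols(2)] eq by (simp add: \<open>t = 0\<close>)
qed

end

theorem theorem1p2:
  fixes N :: nat and m n C \<beta>\<^sub>1 \<beta> B \<alpha> \<gamma>\<^sub>1 :: real
  assumes "N = CARD('d::finite)" and "N \<ge> 3"
    and "m = (real N - 2) / (real N + 2)"
    and "n = 1 - m"
    and "C = 2 * m * ((1 - m) * real N - 2) / n"
    and "\<beta>\<^sub>1 = 1 / (2 * m)"
    and "\<beta> > \<beta>\<^sub>1" and "B > 0"
    and "\<alpha> = (1 + 2 * \<beta>) / n"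
    and "\<gamma>\<^sub>1 = (\<beta> * (real N - 2) - sqrt (\<beta>\<^sup>2 * (real N - 2)\<^sup>2 - 4 * (real N - 2))) / 2"
  shows "\<exists>g :: real ^ 'd \<Rightarrow> real.
           is_profile m n C \<alpha> \<beta> \<gamma>\<^sub>1 B g \<and>
           (\<forall>h. is_profile m n C \<alpha> \<beta> \<gamma>\<^sub>1 B h \<longrightarrow> (\<forall>y. y \<noteq> 0 \<longrightarrow> h y = g y))"
proof -
  interpret fast_diffusion "real N" m n C \<alpha> \<beta> \<gamma>\<^sub>1 "(real N - 2) / 2" "1 / (n * \<beta>)"
      "((real N - 2) / 2)\<^sup>2 - (1 / (n * \<beta>))\<^sup>2"
  proof
    show "3 \<le> real N" using assms(2) by simp
    show "1 / (2 * m) < \<beta>" using assms(6,7) by simp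
  qed (fact assms refl)+
  have dim: "real N = real DIM(real ^ 'd)"
    using assms(1) by simp
  obtain g :: "real ^ 'd \<Rightarrow> real" where "is_profile m n C \<alpha> \<beta> \<gamma>\<^sub>1 B g"
    using profile_exists[OF dim \<open>B > 0\<close>] .
  then show ?thesis
    using profile_unique[OF dim \<open>B > 0\<close>] by blast
qed

end
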